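(* Let $T>0$, let $\varphi$ be a $T$-periodic z-c function with zeros $t_1^o<\dots<t_{m_o}^o<t_1^o+T$ in one period, and let $\mathbf{L}$ be an admissible operator. Let $\mu_c$ be the supremum of all $\mu^*>0$ such that for every $\mu\in[0,\mu^* )$ the equation $$f(t)=\varphi(t)-\mu\,\bigl(\mathbf{L}(\operatorname{sign} f)\bigr)(t)$$ has a $T$-periodic z-c solution $f$ possessing the z-c features of $\varphi$, whose correspondingly labelled zeros $t_1(\mu)<\dots<t_{m_o}(\mu)<t_1(\mu)+T$ are continuous functions of $\mu\in[0,\mu^* )$ with $t_k(0)=t_k^o$ for all $k$. Then $\mu_c<\infty$.
   Context: All functions are real-valued, $\omega=2\pi/T$, $\langle g\rangle=\frac1T\int_0^T g(t)\,dt$, and $\operatorname{sign}0=0$. A $T$-periodic z-c function is a continuous, piecewise $C^1$, $T$-periodic function, not identically zero, with zero average, all of whose zeros are zero-crossings (z-cs): isolated simple zeros $t_*$ at which the two one-sided derivatives are nonzero and have the same sign. Such a function has a finite even number $m\ge 2$ of zeros per period and changes sign at each of them. Let $\varphi$ be a $T$-periodic z-c function with zeros $t_1^o<t_2^o<\dots<t_{m_o}^o<t_1^o+T=:t_{m_o+1}^o$ in one period. A $T$-periodic function $f$ possesses the z-c features of $\varphi$ if $f$ is a $T$-periodic z-c function with exactly $m_o$ zeros per period, which can be labelled $t_1<\dots<t_{m_o}<t_1+T=:t_{m_o+1}$ so that for each $k=1,\dots,m_o$ the sign of $f$ on $(t_k,t_{k+1})$ equals the sign of $\varphi$ on $(t_k^o,t_{k+1}^o)$.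 An admissible operator $\mathbf{L}$ is the steady-state response operator of a linear time-invariant lossless system (convolution with a real kernel), acting on bounded measurable $T$-periodic functions $\zeta=\sum_n\zeta_n e^{in\omega t}$ as the Fourier multiplier $(\mathbf{L}\zeta)_n=\ell(n\omega)\,\zeta_n$, where $\ell$ is the frequency response, $\ell(-\Omega)=\overline{\ell(\Omega)}$, finite at every $\Omega=n\omega$ (no resonance), and: (i) $\mathbf{L}(1)=0$, i.e. $\ell(0)=0$, so that $\mathbf{L}\zeta$ always has zero average; (ii) there are $L_o>0$ and $d\ge2$ with $i\Omega\,\ell(\Omega)-1/L_o=O(|\Omega|^{-d})$ as $|\Omega|\to\infty$; (iii) $\langle\zeta\,\mathbf{L}\zeta\rangle=0$ for every bounded $T$-periodic $\zeta$. *)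

theory Defs
  imports "HOL-Analysis.Analysis" "HOL-Library.Periodic_Fun" "HOL-Library.Landau_Symbols"
begin

definition period_mean :: "real \<Rightarrow> (real \<Rightarrow> 'a::real_normed_vector) \<Rightarrow> 'a" where
  "period_mean T g = (1 / T) *\<^sub>R integral {0..T} g"

definition fourier_coeff :: "real \<Rightarrow> (real \<Rightarrow> real) \<Rightarrow> int \<Rightarrow> complex" where
  "fourier_coeff T g n =
     period_mean T (\<lambda>t. complex_of_real (g t) * cis (- (of_int n * (2 * pi / T) * t)))"

text \<open>
  The library's \<open>piecewise_C1_differentiable_on\<close> puts no condition on the derivative near a
  breakpoint. Here the restriction to each closed piece is \<open>C\<^sup>1\<close> up to its end points, so that the
  one-sided derivatives exist and are finite everywhere.
\<close>

definition piecewise_C1_on :: "(real \<Rightarrow> real) \<Rightarrow> real \<Rightarrow> real \<Rightarrow> bool" where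
  "piecewise_C1_on g a b \<longleftrightarrow>
     (\<exists>(n::nat) (s :: nat \<Rightarrow> real). s 0 = a \<and> s n = b \<and>
        (\<forall>i<n. s i < s (Suc i) \<and>
           (\<exists>g'. continuous_on {s i..s (Suc i)} g' \<and>
              (\<forall>x\<in>{s i..s (Suc i)}.
                 (g has_real_derivative g' x) (at x within {s i..s (Suc i)})))))"

definition zero_crossing :: "(real \<Rightarrow> real) \<Rightarrow> real \<Rightarrow> bool" where
  "zero_crossing g t \<longleftrightarrow>
     t isolated_in {s. g s = 0} \<and>
     (\<exists>l r. (g has_real_derivative l) (at_left t) \<and> (g has_real_derivative r) (at_right t) \<and>
            l \<noteq> 0 \<and> r \<noteq> 0 \<and> sgn l = sgn r)"

definition zc_function :: "real \<Rightarrow> (real \<Rightarrow> real) \<Rightarrow> bool" where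
  "zc_function T g \<longleftrightarrow>
     continuous_on UNIV g \<and> piecewise_C1_on g 0 T \<and> periodic_fun_simple g T \<and>
     (\<exists>t. g t \<noteq> 0) \<and> period_mean T g = 0 \<and>
     (\<forall>t. g t = 0 \<longrightarrow> zero_crossing g t)"

text \<open>
  \<open>t 1 < \<dots> < t m < t (m + 1) = t 1 + T\<close>, where \<open>t 1, \<dots>, t m\<close> are all the zeros in one period.
  The value \<open>t 0\<close> is not used. For \<open>T > 0\<close> the condition excludes \<open>m = 0\<close>.
\<close>

definition zero_labelling :: "real \<Rightarrow> (real \<Rightarrow> real) \<Rightarrow> nat \<Rightarrow> (nat \<Rightarrow> real) \<Rightarrow> bool" where
  "zero_labelling T g m t \<longleftrightarrow>
     (\<forall>k\<in>{1..m}. t k < t (Suc k)) \<and> t (Suc m) = t 1 + T \<and>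
     {s \<in> {t 1..<t 1 + T}. g s = 0} = t ` {1..m}"

definition same_zc_features ::
    "real \<Rightarrow> nat \<Rightarrow> (real \<Rightarrow> real) \<Rightarrow> (nat \<Rightarrow> real) \<Rightarrow> (real \<Rightarrow> real) \<Rightarrow> (nat \<Rightarrow> real) \<Rightarrow> bool" where
  "same_zc_features T m \<phi> t\<^sub>o f t \<longleftrightarrow>
     zc_function T f \<and> zero_labelling T f m t \<and>
     (\<forall>k\<in>{1..m}. \<forall>s\<in>{t k<..<t (Suc k)}. \<forall>s\<^sub>o\<in>{t\<^sub>o k<..<t\<^sub>o (Suc k)}. sgn (f s) = sgn (\<phi> s\<^sub>o))"

definition bounded_periodic :: "real \<Rightarrow> (real \<Rightarrow> real) set" where
  "bounded_periodic T =
     {\<zeta>. \<zeta> \<in> borel_measurable lebesgue \<and> bounded (range \<zeta>) \<and> periodic_fun_simple \<zeta> T}"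

text \<open>
  Only the action of \<open>L\<close> on \<open>bounded_periodic T\<close> is constrained. The Fourier coefficients determine
  \<open>L \<zeta>\<close> up to null sets only; by the decay condition on \<open>l\<close> they are absolutely summable, and \<open>L \<zeta>\<close>
  is the continuous representative, i.e. the pointwise sum of its Fourier series.
  The frequency response \<open>l\<close> may have poles (resonances) away from the integer multiples of
  \<open>2 * pi / T\<close>; its values there are arbitrary and play no role.
\<close>

definition admissible_operator :: "real \<Rightarrow> ((real \<Rightarrow> real) \<Rightarrow> (real \<Rightarrow> real)) \<Rightarrow> bool" where
  "admissible_operator T L \<longleftrightarrow>
     (\<exists>l :: real \<Rightarrow> complex.
        (\<forall>\<Omega>. l (- \<Omega>) = cnj (l \<Omega>)) \<and>
        (\<forall>\<zeta>\<in>bounded_periodic T.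
           continuous_on UNIV (L \<zeta>) \<and> periodic_fun_simple (L \<zeta>) T \<and>
           (\<forall>n::int. fourier_coeff T (L \<zeta>) n
                      = l (of_int n * (2 * pi / T)) * fourier_coeff T \<zeta> n)) \<and>
        l 0 = 0 \<and>
        (\<exists>(L\<^sub>o::real) (d::real). L\<^sub>o > 0 \<and> d \<ge> 2 \<and>
           (\<lambda>\<Omega>. \<i> * complex_of_real \<Omega> * l \<Omega> - complex_of_real (1 / L\<^sub>o))
             \<in> O[at_infinity](\<lambda>\<Omega>. complex_of_real (\<bar>\<Omega>\<bar> powr (- d)))) \<and>
        (\<forall>\<zeta>\<in>bounded_periodic T. period_mean T (\<lambda>t. \<zeta> t * L \<zeta> t) = 0))"

definition solvable_up_to ::
    "real \<Rightarrow> nat \<Rightarrow> (real \<Rightarrow> real) \<Rightarrow> (nat \<Rightarrow> real) \<Rightarrow> ((real \<Rightarrow> real) \<Rightarrow> (real \<Rightarrow> real)) \<Rightarrow> real \<Rightarrow> bool"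
  where
  "solvable_up_to T m \<phi> t\<^sub>o L \<mu>\<^sub>s \<longleftrightarrow>
     (\<exists>(f :: real \<Rightarrow> real \<Rightarrow> real) (t :: real \<Rightarrow> nat \<Rightarrow> real).
        (\<forall>\<mu>\<in>{0..<\<mu>\<^sub>s}.
           same_zc_features T m \<phi> t\<^sub>o (f \<mu>) (t \<mu>) \<and>
           (\<forall>x. f \<mu> x = \<phi> x - \<mu> * L (\<lambda>y. sgn (f \<mu> y)) x)) \<and>
        (\<forall>k\<in>{1..m}. continuous_on {0..<\<mu>\<^sub>s} (\<lambda>\<mu>. t \<mu> k) \<and> t 0 k = t\<^sub>o k))"

definition mu_crit ::
    "real \<Rightarrow> nat \<Rightarrow> (real \<Rightarrow> real) \<Rightarrow> (nat \<Rightarrow> real) \<Rightarrow> ((real \<Rightarrow> real) \<Rightarrow> (real \<Rightarrow> real)) \<Rightarrow> ennreal" where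
  "mu_crit T m \<phi> t\<^sub>o L = Sup {ennreal \<mu>\<^sub>s | \<mu>\<^sub>s. \<mu>\<^sub>s > 0 \<and> solvable_up_to T m \<phi> t\<^sub>o L \<mu>\<^sub>s}"

end

(* Write zeta = sgn f and g = L zeta, so f = phi - mu g. Losslessness gives
   int |f| = int zeta phi, hence the L^1 norm of f is bounded by that of phi, uniformly in mu, and
   the L^1 norm of g is O(1/mu). The decay of the frequency response gives
   g' = (zeta - <zeta>)/L_o + h, where h is dominated by the L^1 distance of zeta to the constants
   and has a modulus of continuity independent of zeta.

   If mu is large, g is small, so on each interval of length epsilon on which zeta is constant,
   zeta is close to p = <zeta> - L_o h at some point. There are at most m sign changes per period,
   so such intervals occur everywhere, and p, which hardly varies on the scale (m+1) epsilon, stays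
   away from 0. Therefore p has one sign, and all intervals on which zeta has the other sign are
   shorter than epsilon. Thus zeta is nearly constant, say nearly 1.

   Let D = int (1 - zeta). Then int |f| = int (zeta - 1) phi = O(D) is small, so mu g must
   balance phi, which together with g = O(D) bounds mu D from below. But then f jumps up by at
   least a constant across the longest interval on which it is negative, although it is small in
   L^1: contradiction. *)

theory Submission
  imports Defs
begin

section \<open>Uniqueness of Fourier coefficients\<close>

text \<open>The formula for g' reflects the expansion of \<open>\<i> * \<Omega> * l \<Omega>\<close>
  into \<open>1 / L\<^sub>o\<close> plus a remainder: the first term returns the input, and the
  remainder is an absolutely summable multiplier because the decay exponent is at least 2. Two
  obstacles shape its proof. The input jumps, so g is not differentiable everywhere; and
  \<open>L\<close> is known only through Fourier coefficients. The formula is therefore proved in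
  integrated form, by comparing the coefficients of g with those of an explicit antiderivative,
  which rests on the uniqueness theorem for continuous periodic functions.

  The gaps between zeros of f have no lower bound. Only their number per period and L^1 norms are
  used, so all constants can be fixed before f.

  The last step needs no lower bound for D alone. The drop of g across the longest negative interval
  and all competing terms are linear in D; after multiplication by \<mu> the comparison takes place
  at the size of \<mu> D, which is bounded below.\<close>

lemma integrable_bounded_borel:
  fixes F :: "real \<Rightarrow> 'a::euclidean_space"
  assumes "F \<in> borel_measurable borel" and "\<And>x. norm (F x) \<le> B"
  shows "F integrable_on {a..b}"
proof (rule measurable_bounded_by_integrable_imp_integrable)
  show "F \<in> borel_measurable (lebesgue_on {a..b})"
    using assms(1) by (simp add: measurable_completion measurable_restrict_space1)
  show "(\<lambda>x. B) integrable_on {a..b}" by (rule integrable_const_ivl)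
qed (use assms(2) in auto)

lemma integral_shift_periodic:
  fixes F :: "real \<Rightarrow> 'a::banach"
  assumes T: "T > 0" and per: "periodic_fun_simple F T"
    and int: "\<And>a b. F integrable_on {a..b}"
  shows "integral {a..a + T} F = integral {0..T} F"
proof -
  interpret periodic_fun_simple F T by (rule per)
  have shift: "integral {x + of_int n * T..y + of_int n * T} F = integral {x..y} F" for x y n
  proof -
    have "F \<circ> (+) (of_int n * T) = F"
      by (rule ext) (simp add: plus_of_int add.commute)
    then show ?thesis
      using integral_shift_Icc_real[of x y F "of_int n * T"] by simp
  qed
  \<comment> \<open>\<open>c\<close> is the multiple of \<open>T\<close> between \<open>a\<close>
    and \<open>a + T\<close>. The part to the left of \<open>c\<close> is moved right by one period,
    which leaves a whole period that starts at a multiple of \<open>T\<close>.\<close>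
  define n where "n = \<lceil>a / T\<rceil>"
  define c where "c = of_int n * T"
  have "a / T \<le> of_int n" "of_int n < a / T + 1" unfolding n_def by linarith+
  then have c: "a \<le> c" "c < a + T" using T by (simp_all add: c_def field_simps)
  have "integral {a..a + T} F = integral {a..c} F + integral {c..a + T} F"
    using Henstock_Kurzweil_Integration.integral_combine[OF _ _ int, of a c "a + T"] c by simp
  also have "integral {a..c} F = integral {a + T..c + T} F"
    using shift[of a 1 c] by simp
  also have "integral {a + T..c + T} F + integral {c..a + T} F = integral {c..c + T} F"
    using Henstock_Kurzweil_Integration.integral_combine[OF _ _ int, of c "a + T" "c + T"] c by (simp add: add.commute)
  also have "\<dots> = integral {0..T} F"
    using shift[of 0 n T] by (simp add: c_def algebra_simps)
  finally show ?thesis .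
qed

section \<open>Vanishing trigonometric moments of a continuous periodic function\<close>

lemma cis_fourier_periodic:
  assumes "T \<noteq> 0" shows "cis (of_int n * (2 * pi / T) * (t + T)) = cis (of_int n * (2 * pi / T) * t)"
proof -
  have "of_int n * (2 * pi / T) * (t + T) = of_int n * (2 * pi / T) * t + 2 * pi * of_int n"
    using assms by (simp add: field_simps)
  then show ?thesis by (simp add: cis_mult[symmetric] cis_multiple_2pi)
qed

text \<open>A factor \<open>cos\<close> averages the frequencies \<open>n + 1\<close> and
  \<open>n - 1\<close>, so the induction on \<open>k\<close> has to carry all \<open>n\<close> at
  once; the claim is the case \<open>n = 0\<close>. The shift \<open>t0\<close> only produces
  unimodular factors.\<close>

lemma integral_cos_power_eq_0:
  fixes u :: "real \<Rightarrow> real"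
  assumes cont: "continuous_on UNIV u"
    and zero: "\<And>n::int. integral {0..T} (\<lambda>t. complex_of_real (u t) * cis (of_int n * (2 * pi / T) * t)) = 0"
  shows "integral {0..T} (\<lambda>t. u t * cos (2 * pi / T * (t - t0)) ^ k) = 0"
proof -
  define w where "w = 2 * pi / T"
  have [continuous_intros]: "continuous_on A u" for A using cont continuous_on_subset by blast
  define I where "I k n = (\<lambda>t. complex_of_real (u t * cos (w * (t - t0)) ^ k) * cis (of_int n * w * t))"
    for k :: nat and n :: int
  have int: "I k n integrable_on {0..T}" for k n
    unfolding I_def by (intro integrable_continuous_interval continuous_intros)
  have "integral {0..T} (I k n) = 0" for n
  proof (induction k arbitrary: n)
    case 0
    show ?case using zero[of n] by (simp add: I_def w_def)
  next
    case (Suc k)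
    have "I (Suc k) n t = cis (- w * t0) / 2 * I k (n + 1) t + cis (w * t0) / 2 * I k (n - 1) t" for t
    proof -
      have c: "complex_of_real (cos (w * (t - t0))) = (cis (w * (t - t0)) + cis (- (w * (t - t0)))) / 2"
        by (simp add: complex_eq_iff)
      have e: "cis (w * (t - t0)) * cis (of_int n * w * t) = cis (- w * t0) * cis (of_int (n + 1) * w * t)"
         "cis (- (w * (t - t0))) * cis (of_int n * w * t) = cis (w * t0) * cis (of_int (n - 1) * w * t)"
        by (simp_all add: cis_mult algebra_simps)
      have "I (Suc k) n t = complex_of_real (u t * cos (w * (t - t0)) ^ k) *
          ((cis (w * (t - t0)) * cis (of_int n * w * t) + cis (- (w * (t - t0))) * cis (of_int n * w * t)) / 2)"
        unfolding I_def power_Suc of_real_mult c by (simp add: field_simps)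
      then show ?thesis unfolding e I_def by (simp add: field_simps)
    qed
    then have "I (Suc k) n = (\<lambda>t. cis (- w * t0) / 2 * I k (n + 1) t + cis (w * t0) / 2 * I k (n - 1) t)"
      by blast
    then show ?case
      by (simp add: Suc.IH integral_add integrable_on_mult_right int del: mult_minus_left)
  qed
  from this[of 0] have "integral {0..T} (\<lambda>t. complex_of_real (u t * cos (w * (t - t0)) ^ k)) = 0"
    by (simp add: I_def)
  moreover have "(\<lambda>t. u t * cos (w * (t - t0)) ^ k) integrable_on {0..T}"
    by (intro integrable_continuous_interval continuous_intros)
  ultimately have "complex_of_real (integral {0..T} (\<lambda>t. u t * cos (w * (t - t0)) ^ k)) = 0"
    using integral_linear[OF _ bounded_linear_of_real[where ?'a = complex], of "\<lambda>t. u t * cos (w * (t - t0)) ^ k" "{0..T}"]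
    by (simp add: o_def)
  then show ?thesis by (simp add: w_def)
qed

text \<open>Testing only the part of \<open>u\<close> that is even about \<open>t0\<close> is
  enough, since twice its value at the centre is \<open>2 * u t0\<close>.\<close>

lemma periodic_eq_0_if_fourier_coeffs_0:
  fixes u :: "real \<Rightarrow> real"
  assumes T: "T > 0" and cont: "continuous_on UNIV u" and per: "periodic_fun_simple u T"
    and zero: "\<And>n::int. integral {0..T} (\<lambda>t. complex_of_real (u t) * cis (of_int n * (2 * pi / T) * t)) = 0"
  shows "u t0 = 0"
proof -
  interpret periodic_fun_simple u T by (rule per)
  define w where "w = 2 * pi / T"
  have w: "w > 0" "w * T = 2 * pi" using T by (auto simp: w_def)
  have cont' [continuous_intros]: "continuous_on A (\<lambda>t. u (v t))" if "continuous_on A v" for A and v :: "real \<Rightarrow> real"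
    using continuous_on_compose2[OF cont that] by simp
  \<comment> \<open>Symmetrising about \<open>t0\<close> gives a continuous function of \<open>cos (w * t)\<close>, to which the
    Weierstrass theorem on an interval applies.\<close>
  define S where "S = (\<lambda>t. u (t0 + t) + u (t0 - t))"
  have contS [continuous_intros]: "continuous_on A (\<lambda>t. S (v t))" if "continuous_on A v" for A and v :: "real \<Rightarrow> real"
    unfolding S_def by (intro continuous_intros that)
  have S_refl: "S (T - t) = S t" for t
  proof -
    have "u (t0 + (T - t)) = u (t0 - t)" using plus_1[of "t0 - t"] by (simp add: algebra_simps)
    moreover have "u (t0 - (T - t)) = u (t0 + t)" using plus_1[of "t0 - (T - t)"] by (simp add: algebra_simps)
    ultimately show ?thesis by (simp add: S_def)
  qed
  define H where "H = (\<lambda>x. S (arccos x / w))"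
  \<comment> \<open>Beyond \<pi> the arccosine returns the reflected angle, and
    \<open>S_refl\<close> says that \<open>S\<close> does not notice the reflection.\<close>
  have H: "S t = H (cos (w * t))" if "t \<in> {0..T}" for t
  proof (cases "w * t \<le> pi")
    case True
    then show ?thesis using that w by (simp add: H_def arccos_cos)
  next
    case False
    have "cos (w * t) = cos (w * (T - t))"
      using w cos_2pi_minus[of "w * t"] by (simp add: algebra_simps)
    moreover have "w * (T - t) \<le> pi" "0 \<le> w * (T - t)" using False w that mult_left_mono[of t T w] by (simp_all add: algebra_simps)
    ultimately have "arccos (cos (w * t)) / w = T - t"
      using w by (simp add: arccos_cos)
    then show ?thesis by (simp add: H_def S_refl)
  qed
  have contH: "continuous_on {-1..1} H"
    unfolding H_def using w by (intro continuous_intros) auto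
  have even: "integral {0..T} (\<lambda>t. S t * cos (w * t) ^ k) = 0" for k
  proof -
    define F where "F = (\<lambda>t. u t * cos (w * (t - t0)) ^ k)"
    have contF: "continuous_on A (\<lambda>t. F (v t))" if "continuous_on A v" for A and v :: "real \<Rightarrow> real"
      unfolding F_def by (intro continuous_intros that)
    have perF: "periodic_fun_simple F T"
    proof
      fix t
      have "cos (w * (t + T - t0)) = cos (w * (t - t0))"
        using w cos.plus_1[of "w * (t - t0)"] by (simp add: algebra_simps)
      then show "F (t + T) = F t" by (simp add: F_def plus_1)
    qed
    have intF: "F integrable_on {a..b}" for a b
      by (rule integrable_continuous_interval) (use contF[of _ "\<lambda>x. x"] in simp)
    have "integral {0..T} F = 0"
      using integral_cos_power_eq_0[OF cont zero] by (simp add: F_def w_def)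
    then have *: "integral {a..a + T} F = 0" for a
      using integral_shift_periodic[OF T perF intF] by simp
    have 1: "integral {0..T} (\<lambda>t. F (t0 + t)) = 0"
      using integral_shift_Icc_real[of 0 T F t0] *[of t0] by (simp add: o_def add.commute)
    have "integral {0..T} (\<lambda>t. F (t0 - t)) = integral {- T..0} (\<lambda>t. F (t0 + t))"
      using Henstock_Kurzweil_Integration.integral_reflect_real[of T 0 "\<lambda>t. F (t0 - t)"] by simp
    also have "\<dots> = 0"
      using integral_shift_Icc_real[of "- T" 0 F t0] *[of "t0 - T"] by (simp add: o_def add.commute)
    finally have 2: "integral {0..T} (\<lambda>t. F (t0 - t)) = 0" .
    have "(\<lambda>t. S t * cos (w * t) ^ k) = (\<lambda>t. F (t0 + t) + F (t0 - t))"
      by (simp add: F_def S_def algebra_simps)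
    then show ?thesis
      using 1 2 by (simp add: integral_add integrable_continuous_interval contF continuous_intros)
  qed
  \<comment> \<open>\<open>S\<close> is orthogonal to every polynomial in
    \<open>cos (w * t)\<close>, so one factor of \<open>S ^ 2\<close> may be replaced by an
    approximation error. The denominator \<open>J + 1\<close> is positive even if \<open>J\<close>
    is 0.\<close>
  have "integral {0..T} (\<lambda>t. S t ^ 2) \<le> e" if e: "e > 0" for e
  proof -
    define J where "J = integral {0..T} (\<lambda>t. \<bar>S t\<bar>)"
    have J: "J \<ge> 0" unfolding J_def by (rule integral_nonneg) (auto intro!: integrable_continuous_interval continuous_intros)
    obtain g where g: "real_polynomial_function g" "\<And>x. x \<in> {-1..1} \<Longrightarrow> \<bar>H x - g x\<bar> < e / (J + 1)"
      using Stone_Weierstrass_real_polynomial_function[of "{-1..1}" H "e / (J + 1)"] contH e J by auto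
    then obtain a N where g_sum: "g = (\<lambda>x. \<Sum>i\<le>N. a i * x ^ i)"
      unfolding real_polynomial_function_iff_sum by blast
    have "integral {0..T} (\<lambda>t. S t * g (cos (w * t)))
        = integral {0..T} (\<lambda>t. \<Sum>i\<le>N. a i * (S t * cos (w * t) ^ i))"
      by (simp add: g_sum sum_distrib_left mult_ac)
    also have "\<dots> = 0"
      by (subst integral_sum) (auto simp: even intro!: integrable_continuous_interval continuous_intros)
    finally have g0: "integral {0..T} (\<lambda>t. S t * g (cos (w * t))) = 0" .
    have contg [continuous_intros]: "continuous_on {0..T} (\<lambda>t. g (cos (w * t)))"
      unfolding g_sum by (intro continuous_intros)
    have "integral {0..T} (\<lambda>t. S t ^ 2) = integral {0..T} (\<lambda>t. S t ^ 2 - S t * g (cos (w * t)))"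
      by (subst integral_diff) (auto simp: g0 intro!: integrable_continuous_interval continuous_intros)
    also have "\<dots> \<le> integral {0..T} (\<lambda>t. e / (J + 1) * \<bar>S t\<bar>)"
    proof (rule integral_le)
      fix t assume t: "t \<in> {0..T}"
      have "S t ^ 2 - S t * g (cos (w * t)) = S t * (H (cos (w * t)) - g (cos (w * t)))"
        using H[OF t] by (simp add: power2_eq_square algebra_simps)
      also have "\<dots> \<le> \<bar>S t\<bar> * \<bar>H (cos (w * t)) - g (cos (w * t))\<bar>"
        by (metis abs_ge_self abs_mult)
      also have "\<dots> \<le> \<bar>S t\<bar> * (e / (J + 1))"
        using g(2)[of "cos (w * t)"] by (intro mult_left_mono) auto
      finally show "S t ^ 2 - S t * g (cos (w * t)) \<le> e / (J + 1) * \<bar>S t\<bar>" by (simp add: mult.commute)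
    qed (use J in \<open>auto intro!: integrable_continuous_interval continuous_intros\<close>)
    also have "\<dots> = e * (J / (J + 1))" by (simp add: J_def)
    also have "\<dots> \<le> e" using e J by (simp add: field_simps)
    finally show ?thesis .
  qed
  then have "integral {0..T} (\<lambda>t. S t ^ 2) \<le> 0" by (rule field_le_epsilon[of _ 0, simplified])
  moreover have "integral {0..T} (\<lambda>t. S t ^ 2) \<ge> 0"
    by (rule integral_nonneg) (auto intro!: integrable_continuous_interval continuous_intros)
  ultimately have "\<forall>t\<in>{0..T}. S t ^ 2 = 0"
    using integral_eq_0_iff[of 0 T "\<lambda>t. S t ^ 2"] T by (simp add: continuous_intros)
  then have "S 0 = 0" using T by auto
  then show ?thesis by (simp add: S_def)
qed

lemma integral_cis_eq_0:
  assumes T: "T > 0" and n: "n \<noteq> (0::int)"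
  shows "integral {0..T} (\<lambda>t. cis (of_int n * (2 * pi / T) * t)) = 0"
proof -
  define w where "w = of_int n * (2 * pi / T)"
  have w: "w \<noteq> 0" using T n by (simp add: w_def)
  have "((\<lambda>t. cis (w * t)) has_integral (cis (w * T) / (\<i> * w) - cis (w * 0) / (\<i> * w))) {0..T}"
  proof (rule fundamental_theorem_of_calculus)
    show "((\<lambda>t. cis (w * t) / (\<i> * complex_of_real w)) has_vector_derivative cis (w * t)) (at t within {0..T})" for t
      unfolding has_vector_derivative_def
      using w by (auto intro!: derivative_eq_intros simp: fun_eq_iff scaleR_conv_of_real)
        (simp add: complex_eq_iff)
  qed (use T in simp)
  moreover have "cis (w * T) = 1"
    using cis_fourier_periodic[of T n 0] T by (simp add: w_def)
  ultimately show ?thesis by (simp add: w_def integral_unique)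
qed

text \<open>The moment of \<open>Re F\<close> at \<open>n\<close> is the average of that of
  \<open>F\<close> at \<open>n\<close> and the conjugate of that at \<open>- n\<close>; subtracting
  the mean settles \<open>n = 0\<close>. \<open>F\<close> is complex because the series to which
  this is applied is not shown to be real.\<close>

lemma real_part_constant_if_fourier_coeffs_0:
  fixes F :: "real \<Rightarrow> complex"
  assumes T: "T > 0" and cont: "continuous_on UNIV F" and per: "\<And>t. F (t + T) = F t"
    and zero: "\<And>n::int. n \<noteq> 0 \<Longrightarrow> integral {0..T} (\<lambda>t. F t * cis (of_int n * (2 * pi / T) * t)) = 0"
  shows "Re (F x) = Re (F y)"
proof -
  have cont' [continuous_intros]: "continuous_on A F" for A
    using cont continuous_on_subset by blast
  define c where "c = period_mean T (\<lambda>t. Re (F t))"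
  define u where "u = (\<lambda>t. Re (F t) - c)"
  have "integral {0..T} (\<lambda>t. complex_of_real (u t) * cis (of_int n * (2 * pi / T) * t)) = 0" for n :: int
  proof (cases "n = 0")
    case True
    have "integral {0..T} u = integral {0..T} (\<lambda>t. Re (F t)) - integral {0..T} (\<lambda>t. c)"
      unfolding u_def by (intro integral_diff integrable_continuous_interval continuous_intros)
    then have "integral {0..T} u = 0"
      using T by (simp add: c_def period_mean_def)
    moreover have "u integrable_on {0..T}"
      unfolding u_def by (intro integrable_continuous_interval continuous_intros)
    ultimately have "((\<lambda>t. complex_of_real (u t)) has_integral of_real 0) {0..T}"
      by (metis has_integral_of_real integrable_integral)
    then show ?thesis using True by (simp add: integral_unique)
  next
    case False
    define I where "I k = (\<lambda>t. F t * cis (of_int k * (2 * pi / T) * t))" for k :: int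
    have int: "I k integrable_on {0..T}" for k
      unfolding I_def by (intro integrable_continuous_interval continuous_intros)
    have int_cis: "(\<lambda>t. of_real c * cis (of_int n * (2 * pi / T) * t)) integrable_on {0..T}"
      by (intro integrable_continuous_interval continuous_intros)
    have "complex_of_real (u t) * cis (of_int n * (2 * pi / T) * t)
        = (I n t + cnj (I (- n) t)) / 2 - of_real c * cis (of_int n * (2 * pi / T) * t)" for t
      by (simp add: u_def I_def complex_eq_iff field_simps)
    moreover have "integral {0..T} (\<lambda>t. (I n t + cnj (I (- n) t)) / 2 - of_real c * cis (of_int n * (2 * pi / T) * t))
        = (integral {0..T} (I n) + cnj (integral {0..T} (I (- n)))) / 2
           - of_real c * integral {0..T} (\<lambda>t. cis (of_int n * (2 * pi / T) * t))"
      by (subst integral_diff[OF _ int_cis])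
        (simp_all add: int integral_add integral_cnj integrable_on_cnj_iff integrable_add)
    ultimately show ?thesis
      using zero[of n] zero[of "- n"] integral_cis_eq_0[OF T False] False by (simp add: I_def)
  qed
  moreover have "continuous_on UNIV u" unfolding u_def by (intro continuous_intros)
  moreover have "periodic_fun_simple u T" by standard (simp add: u_def per)
  ultimately have "u t = 0" for t
    by (intro periodic_eq_0_if_fourier_coeffs_0[OF T])
  from this[of x] this[of y] show ?thesis by (simp add: u_def)
qed

section \<open>Absolutely convergent Fourier series\<close>

lemma
  fixes c :: "int \<Rightarrow> complex"
  assumes T: "T > 0" and c: "(\<lambda>n. norm (c n)) summable_on UNIV"
  defines "h \<equiv> (\<lambda>t. \<Sum>\<^sub>\<infinity>n. c n * cis (of_int n * (2 * pi / T) * t))"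
  shows continuous_on_fourier_series: "continuous_on UNIV h"
    and fourier_series_has_integral:
      "((\<lambda>t. h t * cis (- (of_int n * (2 * pi / T) * t))) has_integral T * c n) {0..T}"
proof -
  define e where "e n t = cis (of_int n * (2 * pi / T) * t)" for n t
  \<comment> \<open>The limit runs over finite sets of frequencies ordered by inclusion. Uniform
    convergence serves both conclusions: continuity, and integration term by term.\<close>
  have lim: "uniform_limit Y (\<lambda>X t. \<Sum>n\<in>X. c n * e n t) h (finite_subsets_at_top UNIV)" for Y
    unfolding h_def e_def by (rule Weierstrass_m_test_general[OF _ c]) (simp add: norm_mult)
  have contS: "continuous_on A (\<lambda>t. \<Sum>n\<in>X. c n * e n t)" for A X
    unfolding e_def by (intro continuous_intros)
  show cont: "continuous_on UNIV h"
    by (rule uniform_limit_theorem[OF _ lim]) (simp_all add: contS)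
  have e_mult: "e k t * cis (- (of_int n * (2 * pi / T) * t)) = e (k - n) t" for k t
    by (simp add: e_def cis_mult algebra_simps diff_divide_distrib)
  have lim': "uniform_limit {0..T} (\<lambda>X t. \<Sum>k\<in>X. c k * e (k - n) t)
      (\<lambda>t. h t * cis (- (of_int n * (2 * pi / T) * t))) (finite_subsets_at_top UNIV)"
  proof -
    have "uniform_limit {0..T} (\<lambda>X t. \<Sum>k\<in>X. c k * e (k - n) t)
        (\<lambda>t. \<Sum>\<^sub>\<infinity>k. c k * e (k - n) t) (finite_subsets_at_top UNIV)"
      by (rule Weierstrass_m_test_general[OF _ c]) (simp add: norm_mult e_def)
    moreover have "(\<Sum>\<^sub>\<infinity>k. c k * e (k - n) t) = h t * cis (- (of_int n * (2 * pi / T) * t))" for t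
      unfolding e_mult[symmetric] mult.assoc[symmetric]
      by (simp add: infsum_cmult_left' h_def e_def)
    ultimately show ?thesis by simp
  qed
  have contS': "continuous_on {0..T} (\<lambda>t. \<Sum>k\<in>X. c k * e (k - n) t)" for X
    unfolding e_def by (intro continuous_intros)
  obtain I J where IJ: "\<And>X. ((\<lambda>t. \<Sum>k\<in>X. c k * e (k - n) t) has_integral I X) {0..T}"
      "((\<lambda>t. h t * cis (- (of_int n * (2 * pi / T) * t))) has_integral J) {0..T}"
      "(I \<longlongrightarrow> J) (finite_subsets_at_top UNIV)"
    using uniform_limit_integral[OF lim' contS'] by auto
  have int_e: "e k integrable_on {0..T}" for k
    unfolding e_def by (intro integrable_continuous_interval continuous_intros)
  have "I X = T * c n" if "finite X" "n \<in> X" for X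
  proof -
    have "I X = integral {0..T} (\<lambda>t. \<Sum>k\<in>X. c k * e (k - n) t)"
      using IJ(1)[of X] by (simp add: integral_unique)
    also have "\<dots> = (\<Sum>k\<in>X. c k * integral {0..T} (e (k - n)))"
      by (subst integral_sum) (simp_all add: that int_e integrable_on_mult_right)
    also have "\<dots> = (\<Sum>k\<in>X. if k = n then T * c n else 0)"
    proof (rule sum.cong)
      fix k assume "k \<in> X"
      show "c k * integral {0..T} (e (k - n)) = (if k = n then T * c n else 0)"
      proof (cases "k = n")
        case True
        have "e 0 = (\<lambda>t. 1)" by (simp add: e_def fun_eq_iff)
        then show ?thesis using True T by (simp add: scaleR_conv_of_real)
      next
        case False
        have "e (k - n) = (\<lambda>t. cis (of_int (k - n) * (2 * pi / T) * t))" by (simp add: e_def fun_eq_iff)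
        then show ?thesis using False integral_cis_eq_0[OF T, of "k - n"] by simp
      qed
    qed simp
    finally show ?thesis using that by simp
  qed
  \<comment> \<open>Once \<open>X\<close> contains \<open>n\<close> the integral no longer changes,
    because every other term has nonzero frequency.\<close>
  then have "\<forall>\<^sub>F X in finite_subsets_at_top UNIV. I X = T * c n"
    unfolding eventually_finite_subsets_at_top by (intro exI[of _ "{n}"]) auto
  then have "(I \<longlongrightarrow> T * c n) (finite_subsets_at_top UNIV)"
    by (rule tendsto_eventually)
  then have "J = T * c n"
    using tendsto_unique[OF _ IJ(3)] by simp
  with IJ(2) show "((\<lambda>t. h t * cis (- (of_int n * (2 * pi / T) * t))) has_integral T * c n) {0..T}"
    by simp
qed

text \<open>Integration by parts. The boundary terms vanish because the antiderivative is 0 at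
  \<open>0\<close> and, by \<open>mean\<close>, also at \<open>T\<close>. The exceptional set
  \<open>S\<close> accommodates the jumps of square waves.\<close>

lemma has_integral_antiderivative_cis:
  fixes w :: "real \<Rightarrow> complex"
  assumes T: "T > 0" and n: "n \<noteq> (0::int)" and int: "w integrable_on {0..T}" and mean: "integral {0..T} w = 0"
    and S: "finite S" and cont: "\<And>x. x \<in> {0<..<T} - S \<Longrightarrow> isCont w x"
    and wn: "integral {0..T} (\<lambda>t. w t * cis (of_int n * (2 * pi / T) * t)) = y"
  shows "integral {0..T} (\<lambda>t. integral {0..t} w * cis (of_int n * (2 * pi / T) * t))
     = - y / (\<i> * (of_int n * (2 * pi / T)))"
proof -
  define v where "v = of_int n * (2 * pi / T)"
  have v: "v \<noteq> 0" using T n by (simp add: v_def)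
  define Q where "Q = integral {0..T} (\<lambda>t. integral {0..t} w * cis (v * t))"
  define b where "b = (\<lambda>t. cis (v * t) / (\<i> * complex_of_real v))"
  have contG: "continuous_on {0..T} (\<lambda>t. integral {0..t} w)"
    by (rule indefinite_integral_continuous_1[OF int])
  have "((\<lambda>t. w t * b t) has_integral - Q) {0..T}"
  proof (rule integration_by_parts_interior_strong[OF bounded_bilinear_mult S])
    show "continuous_on {0..T} (\<lambda>t. integral {0..t} w)" by (rule contG)
    show "continuous_on {0..T} b" using v unfolding b_def by (intro continuous_intros) auto
    show "(b has_vector_derivative cis (v * t)) (at t)" for t
      unfolding has_vector_derivative_def b_def
      using v by (auto intro!: derivative_eq_intros simp: fun_eq_iff scaleR_conv_of_real)
        (simp add: complex_eq_iff)
    show "((\<lambda>t. integral {0..t} w) has_vector_derivative w x) (at x)" if x: "x \<in> {0<..<T} - S" for x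
    proof -
      have "((\<lambda>t. integral {0..t} w) has_vector_derivative w x) (at x within {0..T} - {})"
        by (rule integral_has_vector_derivative_continuous_at[OF int])
          (use x cont[OF x] continuous_at_imp_continuous_at_within in auto)
      then show ?thesis using x at_within_Icc_at[of 0 x T] by auto
    qed
    have "((\<lambda>t. integral {0..t} w * cis (v * t)) has_integral Q) {0..T}"
      unfolding Q_def by (intro integrable_integral integrable_continuous_interval continuous_intros contG)
    then show "((\<lambda>t. integral {0..t} w * cis (v * t)) has_integral
      integral {0..T} w * b T - integral {0..0} w * b 0 - - Q) {0..T}"
      using mean by simp
  qed (use T in simp)
  then have "((\<lambda>t. w t * b t * (\<i> * complex_of_real v)) has_integral - Q * (\<i> * complex_of_real v)) {0..T}"
    by (rule has_integral_mult_left)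
  then have "((\<lambda>t. w t * cis (v * t)) has_integral - Q * (\<i> * complex_of_real v)) {0..T}"
    using v by (simp add: b_def)
  then have "y = - Q * (\<i> * complex_of_real v)"
    using wn by (simp add: v_def integral_unique)
  then show ?thesis
    using v by (simp add: Q_def v_def)
qed

section \<open>The operator on square waves\<close>

text \<open>The antiderivative of \<open>w\<close> is periodic because \<open>w\<close> has mean
  zero, and at every nonzero frequency it has the same coefficient as \<open>g\<close>; hence the
  real parts of the two differ by a constant. This expresses that \<open>g\<close> has derivative
  \<open>Re w\<close> even though \<open>w\<close> may jump.\<close>

lemma increment_eq_integral_if_fourier_coeffs:
  fixes g :: "real \<Rightarrow> real" and w :: "real \<Rightarrow> complex"
  assumes T: "T > 0" and contg: "continuous_on UNIV g" and perg: "\<And>t. g (t + T) = g t"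
    and int: "\<And>a b. w integrable_on {a..b}" and bound: "\<And>x. norm (w x) \<le> B"
    and perw: "periodic_fun_simple w T"
    and S: "finite S" and cont: "\<And>x. x \<in> {0<..<T} - S \<Longrightarrow> isCont w x"
    and mean: "integral {0..T} w = 0"
    and coeff: "\<And>n::int. n \<noteq> 0 \<Longrightarrow> integral {0..T} (\<lambda>t. w t * cis (of_int n * (2 * pi / T) * t))
       = - (\<i> * (of_int n * (2 * pi / T))) * integral {0..T} (\<lambda>t. complex_of_real (g t) * cis (of_int n * (2 * pi / T) * t))"
    and ab: "a \<le> b"
  shows "g b - g a = integral {a..b} (\<lambda>x. Re (w x))"
proof -
  \<comment> \<open>An oriented integral: one of the two terms vanishes because its interval is empty.\<close>
  define G where "G t = integral {0..t} w - integral {t..0} w" for t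
  have G_diff: "G y - G x = integral {x..y} w" if "x \<le> y" for x y
  proof -
    note combine = Henstock_Kurzweil_Integration.integral_combine[OF _ _ int]
    consider "0 \<le> x" | "x \<le> 0" "0 \<le> y" | "y \<le> 0" by linarith
    then show ?thesis
    proof cases
      case 1
      then have "integral {0..x} w + integral {x..y} w = integral {0..y} w"
        using that by (intro combine) auto
      moreover have "integral {x..0} w = 0" "integral {y..0} w = 0" using 1 that by (cases "x = 0"; cases "y = 0"; simp)+
      ultimately show ?thesis by (simp add: G_def algebra_simps)
    next
      case 2
      then have "integral {x..0} w + integral {0..y} w = integral {x..y} w"
        by (intro combine) auto
      moreover have "integral {0..x} w = 0" "integral {y..0} w = 0" using 2 by (cases "x = 0"; cases "y = 0"; simp)+
      ultimately show ?thesis by (simp add: G_def algebra_simps)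
    next
      case 3
      then have "integral {x..y} w + integral {y..0} w = integral {x..0} w"
        using that by (intro combine) auto
      moreover have "integral {0..x} w = 0" "integral {0..y} w = 0" using 3 that by (cases "x = 0"; cases "y = 0"; simp)+
      ultimately show ?thesis by (simp add: G_def algebra_simps)
    qed
  qed
  have B: "B \<ge> 0" using bound[of 0] norm_ge_zero order_trans by blast
  have G_lip: "dist (G x) (G y) \<le> B * dist x y" for x y
  proof -
    have *: "norm (G y - G x) \<le> B * (y - x)" if "x \<le> y" for x y
      using has_integral_bound_real[OF B finite.emptyI integrable_integral[OF int[of x y]]] bound that
      by (simp add: G_diff)
    show ?thesis
      using *[of x y] *[of y x] by (cases "x \<le> y") (auto simp: dist_norm norm_minus_commute abs_real_def)
  qed
  then have contG: "continuous_on UNIV G"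
    using B by (intro lipschitz_on_continuous_on[of B] lipschitz_onI) auto
  have perG: "G (t + T) = G t" for t
    using G_diff[of t "t + T"] integral_shift_periodic[OF T perw int, of t] mean T by simp
  define F where "F t = complex_of_real (g t) - G t" for t
  have contg' [continuous_intros]: "continuous_on A g" and contG' [continuous_intros]: "continuous_on A G" for A
    using contg contG continuous_on_subset by blast+
  have "Re (F b) = Re (F a)"
  proof (rule real_part_constant_if_fourier_coeffs_0[OF T])
    show "continuous_on UNIV F" unfolding F_def by (intro continuous_intros)
    show "F (t + T) = F t" for t by (simp add: F_def perG perg)
    fix n :: int assume n: "n \<noteq> 0"
    define v where "v = of_int n * (2 * pi / T)"
    have v: "v \<noteq> 0" using n T by (simp add: v_def)
    define I where "I = integral {0..T} (\<lambda>t. complex_of_real (g t) * cis (v * t))"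
    have "integral {0..T} (\<lambda>t. G t * cis (v * t)) = integral {0..T} (\<lambda>t. integral {0..t} w * cis (v * t))"
    proof (rule integral_cong)
      fix t assume "t \<in> {0..T}"
      then have "integral {t..0} w = 0" by (cases "t = 0") auto
      then show "G t * cis (v * t) = integral {0..t} w * cis (v * t)" by (simp add: G_def)
    qed
    also have "\<dots> = I"
      using has_integral_antiderivative_cis[OF T n int mean S cont coeff[OF n]] v by (simp add: v_def I_def)
    finally have "integral {0..T} (\<lambda>t. G t * cis (v * t)) = I" .
    moreover have "integral {0..T} (\<lambda>t. F t * cis (v * t)) = I - integral {0..T} (\<lambda>t. G t * cis (v * t))"
      unfolding F_def I_def left_diff_distrib
      by (intro integral_diff integrable_continuous_interval continuous_intros)
    ultimately show "integral {0..T} (\<lambda>t. F t * cis (of_int n * (2 * pi / T) * t)) = 0"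
      by (simp add: v_def)
  qed
  then have "g b - g a = Re (G b - G a)" by (simp add: F_def)
  also have "\<dots> = integral {a..b} (\<lambda>x. Re (w x))"
    using integral_linear[OF int bounded_linear_Re, of a b] G_diff[OF ab] by (simp add: o_def)
  finally show ?thesis .
qed

section \<open>The remainder series, with bounds uniform in the input\<close>

lemma summable_on_intI:
  fixes f :: "int \<Rightarrow> real"
  assumes "(\<lambda>n. f (int n)) summable_on UNIV" "(\<lambda>n. f (- int n)) summable_on UNIV"
  shows "f summable_on UNIV"
proof -
  have "f summable_on range int"
    using assms(1) by (subst summable_on_reindex) (auto simp: o_def)
  moreover have "f summable_on ((\<lambda>n. - int n) ` {1..})"
    using summable_on_subset_banach[OF assms(2), of "{1..}"]
    by (subst summable_on_reindex) (auto simp: o_def inj_on_def)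
  moreover have "range int \<inter> (\<lambda>n. - int n) ` {1..} = {}" by auto
  moreover have "range int \<union> (\<lambda>n. - int n) ` {1..} = UNIV"
  proof (intro equalityI subsetI UNIV_I)
    fix k :: int
    show "k \<in> range int \<union> (\<lambda>n. - int n) ` {1..}"
    proof (cases "k \<ge> 0")
      case True
      then show ?thesis by (metis UnI1 nat_0_le rangeI)
    next
      case False
      then have "k = - int (nat (- k))" "nat (- k) \<in> {1..}" by auto
      then show ?thesis by blast
    qed
  qed
  ultimately show ?thesis
    using summable_on_Un_disjoint[of f "range int" "(\<lambda>n. - int n) ` {1..}"] by simp
qed

lemma summable_on_lattice_if_decay:
  fixes \<rho> :: "real \<Rightarrow> complex"
  assumes w: "w > 0" and d: "d \<ge> 2"
    and O: "\<rho> \<in> O[at_infinity](\<lambda>\<Omega>. complex_of_real (\<bar>\<Omega>\<bar> powr (- d)))"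
  shows "(\<lambda>n::int. norm (\<rho> (of_int n * w))) summable_on UNIV"
proof -
  obtain c where c: "c > 0" "\<forall>\<^sub>F \<Omega> in at_infinity. norm (\<rho> \<Omega>) \<le> c * norm (complex_of_real (\<bar>\<Omega>\<bar> powr (- d)))"
    using O by (elim landau_o.bigE)
  then obtain b where b: "\<And>\<Omega>. norm \<Omega> \<ge> b \<Longrightarrow> norm (\<rho> \<Omega>) \<le> c * (\<bar>\<Omega>\<bar> powr (- d))"
    by (auto simp: eventually_at_infinity)
  \<comment> \<open>Beyond \<open>b\<close> the Landau bound holds; beyond 1 a power with exponent
    \<open>- d\<close> is at most the one with exponent \<open>- 2\<close>.\<close>
  obtain N :: nat where N: "real N * w \<ge> max b 1"
    using reals_Archimedean3[OF w] less_imp_le by meson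
  have *: "norm (\<rho> \<Omega>) \<le> c / w\<^sup>2 * (1 / real n ^ 2)" if n: "n \<ge> N" and \<Omega>: "\<bar>\<Omega>\<bar> = real n * w" for n \<Omega>
  proof -
    have "real N * w \<le> real n * w" using n w by simp
    then have 1: "\<bar>\<Omega>\<bar> \<ge> max b 1" using N \<Omega> by linarith
    then have "norm (\<rho> \<Omega>) \<le> c * (\<bar>\<Omega>\<bar> powr (- d))" using b by simp
    also have "\<bar>\<Omega>\<bar> powr (- d) \<le> \<bar>\<Omega>\<bar> powr (- 2)" using 1 d by (intro powr_mono) auto
    also have "\<bar>\<Omega>\<bar> powr (- 2) = 1 / (real n * w) ^ 2"
      using 1 by (simp add: powr_minus_divide \<Omega>)
    finally show ?thesis using c by (simp add: power_mult_distrib field_simps)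
  qed
  have "summable (\<lambda>n. c / w\<^sup>2 * (1 / real n ^ 2))"
    using inverse_power_summable[of 2] by (intro summable_mult) (simp add: field_simps)
  then have "summable (\<lambda>n. norm (\<rho> (s * real n * w)))" if "\<bar>s\<bar> = 1" for s
  proof (rule summable_comparison_test_ev[rotated])
    show "\<forall>\<^sub>F n in sequentially. norm (norm (\<rho> (s * real n * w))) \<le> c / w\<^sup>2 * (1 / real n ^ 2)"
      using eventually_ge_at_top[of N]
    proof eventually_elim
      case (elim n)
      show ?case using *[OF elim, of "s * real n * w"] w that by (simp add: abs_mult)
    qed
  qed
  from this[of 1] this[of "-1"] show ?thesis
    by (intro summable_on_intI norm_summable_imp_summable_on) auto
qed

text \<open>A constant has no coefficient at a nonzero frequency, so any \<open>c\<close> may be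
  subtracted first. This is what later makes \<open>h\<close> small when the input is close to some
  constant.\<close>

lemma norm_fourier_coeff_le:
  assumes T: "T > 0" and n: "n \<noteq> 0" and \<zeta>: "\<zeta> \<in> borel_measurable borel" "\<And>x. \<bar>\<zeta> x\<bar> \<le> B"
  shows "norm (fourier_coeff T \<zeta> n) \<le> integral {0..T} (\<lambda>x. \<bar>\<zeta> x - c\<bar>) / T"
proof -
  define e where "e t = cis (- (of_int n * (2 * pi / T) * t))" for t
  have e [measurable]: "e \<in> borel_measurable borel"
    unfolding e_def by (intro borel_measurable_continuous_onI continuous_intros)
  have [measurable]: "\<zeta> \<in> borel_measurable borel" by (rule \<zeta>)
  have norm_e: "norm (e t) = 1" for t by (simp add: e_def)
  have "integral {0..T} e = 0"
    using integral_cis_eq_0[OF T, of "- n"] n by (simp add: e_def[abs_def])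
  moreover have e_int: "e integrable_on {0..T}"
    by (rule integrable_bounded_borel[of _ 1]) (simp_all add: norm_e)
  moreover have \<zeta>e_int: "(\<lambda>t. complex_of_real (\<zeta> t) * e t) integrable_on {0..T}"
    by (rule integrable_bounded_borel[of _ B]) (simp_all add: norm_e norm_mult \<zeta>)
  ultimately have "integral {0..T} (\<lambda>t. complex_of_real (\<zeta> t) * e t) = integral {0..T} (\<lambda>t. complex_of_real (\<zeta> t) * e t - of_real c * e t)"
    by (subst integral_diff) (simp_all add: integrable_on_mult_right)
  also have "norm \<dots> \<le> integral {0..T} (\<lambda>x. \<bar>\<zeta> x - c\<bar>)"
  proof (rule integral_norm_bound_integral)
    show "(\<lambda>t. complex_of_real (\<zeta> t) * e t - of_real c * e t) integrable_on {0..T}"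
      using \<zeta>e_int e_int by (intro integrable_diff integrable_on_mult_right)
    show "(\<lambda>x. \<bar>\<zeta> x - c\<bar>) integrable_on {0..T}"
    proof (rule integrable_bounded_borel)
      show "norm \<bar>\<zeta> x - c\<bar> \<le> B + \<bar>c\<bar>" for x using \<zeta>(2)[of x] by simp
    qed simp
    show "norm (complex_of_real (\<zeta> x) * e x - of_real c * e x) \<le> \<bar>\<zeta> x - c\<bar>" for x
      by (simp add: left_diff_distrib[symmetric] norm_mult e_def flip: of_real_diff)
  qed
  finally show ?thesis
    using T by (simp add: fourier_coeff_def period_mean_def e_def field_simps)
qed

text \<open>\<open>R\<close> and \<open>d\<close> are chosen before the coefficients
  \<open>z\<close>, so they serve all inputs of the operator at once. \<open>R\<close> is the sum of
  the norms of \<open>\<rho>\<close>.\<close>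

lemma fourier_series_bounds:
  fixes \<rho> :: "int \<Rightarrow> complex" and T e :: real
  assumes T: "T > 0" and \<rho>: "(\<lambda>n. norm (\<rho> n)) summable_on UNIV" and e: "e > 0"
  obtains R d where "R \<ge> 0" "d > 0"
    and "\<And>z B t. \<forall>n. norm (z n) \<le> norm (\<rho> n) * B \<Longrightarrow>
      norm (\<Sum>\<^sub>\<infinity>n. z n * cis (of_int n * (2 * pi / T) * t)) \<le> R * B"
    and "\<And>z s t. \<forall>n. norm (z n) \<le> norm (\<rho> n) \<Longrightarrow> \<bar>s - t\<bar> \<le> d \<Longrightarrow>
      norm ((\<Sum>\<^sub>\<infinity>n. z n * cis (of_int n * (2 * pi / T) * s))
           - (\<Sum>\<^sub>\<infinity>n. z n * cis (of_int n * (2 * pi / T) * t))) \<le> e"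
proof -
  define E where "E n t = cis (of_int n * (2 * pi / T) * t)" for n :: int and t
  \<comment> \<open>A modulus of continuity common to all the series.\<close>
  define W where "W s = (\<Sum>\<^sub>\<infinity>n. norm (\<rho> n) * norm (E n s - 1))" for s
  have E_le: "norm (E n s - 1) \<le> 2" for n s
    using norm_triangle_ineq4[of "E n s" 1] by (simp add: E_def)
  have sum2: "(\<lambda>n. norm (\<rho> n) * 2) summable_on UNIV"
    by (rule summable_on_cmult_left[OF \<rho>])
  have "continuous_on UNIV W"
  proof (rule uniform_limit_theorem)
    show "uniform_limit UNIV (\<lambda>X s. \<Sum>n\<in>X. norm (\<rho> n) * norm (E n s - 1)) W (finite_subsets_at_top UNIV)"
      unfolding W_def by (rule Weierstrass_m_test_general[OF _ sum2]) (use E_le in \<open>auto intro!: mult_left_mono\<close>)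
  qed (use T in \<open>auto simp: E_def intro!: always_eventually continuous_intros\<close>)
  then have "isCont W 0" by (simp add: continuous_on_eq_continuous_at)
  moreover have "W 0 = 0" by (simp add: W_def E_def)
  ultimately have "\<exists>d>0. \<forall>s. dist s 0 < d \<longrightarrow> dist (W s) 0 < e"
    using e unfolding continuous_at_eps_delta by metis
  then obtain d where d: "d > 0" "\<And>s. \<bar>s\<bar> < d \<Longrightarrow> \<bar>W s\<bar> < e"
    by auto
  define R where "R = (\<Sum>\<^sub>\<infinity>n. norm (\<rho> n))"
  show ?thesis
  proof (rule that)
    show "R \<ge> 0" unfolding R_def by (rule infsum_nonneg) simp
    \<comment> \<open>\<open>W\<close> is controlled under a strict inequality, while the claim
      allows equality; hence the half.\<close>
    show "d / 2 > 0" using d by simp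
    fix z :: "int \<Rightarrow> complex" and B t
    assume z: "\<forall>n. norm (z n) \<le> norm (\<rho> n) * B"
    have s: "(\<lambda>n. norm (\<rho> n) * B) summable_on UNIV" by (rule summable_on_cmult_left[OF \<rho>])
    have a: "(\<lambda>n. norm (z n * E n t)) summable_on UNIV"
      by (rule Infinite_Sum.abs_summable_on_comparison_test'[OF s]) (use z in \<open>simp add: norm_mult E_def\<close>)
    have "norm (\<Sum>\<^sub>\<infinity>n. z n * E n t) \<le> (\<Sum>\<^sub>\<infinity>n. norm (z n * E n t))"
      by (rule norm_infsum_bound[OF a])
    also have "\<dots> \<le> (\<Sum>\<^sub>\<infinity>n. norm (\<rho> n) * B)"
      by (rule infsum_mono[OF a s]) (use z in \<open>simp add: norm_mult E_def\<close>)
    also have "\<dots> = R * B" unfolding R_def by (rule infsum_cmult_left')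
    finally show "norm (\<Sum>\<^sub>\<infinity>n. z n * cis (of_int n * (2 * pi / T) * t)) \<le> R * B" by (simp add: E_def)
  next
    fix z :: "int \<Rightarrow> complex" and s t
    assume z: "\<forall>n. norm (z n) \<le> norm (\<rho> n)" and st: "\<bar>s - t\<bar> \<le> d / 2"
    have a: "(\<lambda>n. z n * E n u) summable_on UNIV" for u
      by (rule abs_summable_summable, rule Infinite_Sum.abs_summable_on_comparison_test'[OF \<rho>])
        (use z in \<open>simp add: norm_mult E_def\<close>)
    have E_diff: "norm (E n s - E n t) = norm (E n (s - t) - 1)" for n
    proof -
      have "E n s - E n t = E n t * (E n (s - t) - 1)"
        by (simp add: E_def right_diff_distrib cis_mult algebra_simps diff_divide_distrib)
      then show ?thesis by (simp add: norm_mult E_def)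
    qed
    have W: "(\<lambda>n. norm (\<rho> n) * norm (E n u - 1)) summable_on UNIV" for u
      by (rule summable_on_comparison_test[OF sum2]) (use E_le in \<open>auto intro!: mult_left_mono\<close>)
    have le: "norm (z n * E n s - z n * E n t) \<le> norm (\<rho> n) * norm (E n (s - t) - 1)" for n
      unfolding right_diff_distrib[symmetric] norm_mult E_diff using z by (intro mult_right_mono) auto
    have b: "(\<lambda>n. norm (z n * E n s - z n * E n t)) summable_on UNIV"
      by (rule Infinite_Sum.abs_summable_on_comparison_test'[OF W le])
    have neg: "(\<lambda>n. - (z n * E n t)) summable_on UNIV" using a by (simp add: summable_on_uminus)
    have "(\<Sum>\<^sub>\<infinity>n. z n * E n s) - (\<Sum>\<^sub>\<infinity>n. z n * E n t) = (\<Sum>\<^sub>\<infinity>n. z n * E n s - z n * E n t)"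
      using infsum_add[OF a[of s] neg] by (simp add: infsum_uminus)
    also have "norm \<dots> \<le> (\<Sum>\<^sub>\<infinity>n. norm (z n * E n s - z n * E n t))"
      by (rule norm_infsum_bound[OF b])
    also have "\<dots> \<le> W (s - t)" unfolding W_def by (rule infsum_mono[OF b W le])
    also have "\<dots> \<le> e" using d(2)[of "s - t"] st d(1) by auto
    finally show "norm ((\<Sum>\<^sub>\<infinity>n. z n * cis (of_int n * (2 * pi / T) * s))
           - (\<Sum>\<^sub>\<infinity>n. z n * cis (of_int n * (2 * pi / T) * t))) \<le> e" by (simp add: E_def)
  qed
qed

text \<open>The bound 1 makes the modulus of continuity of \<open>h\<close> independent of the
  input, and finiteness of the discontinuities is what integration by parts requires.\<close>

definition wave_input :: "real \<Rightarrow> (real \<Rightarrow> real) \<Rightarrow> bool" where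
  "wave_input T \<zeta> \<longleftrightarrow> \<zeta> \<in> borel_measurable borel \<and> (\<forall>x. \<bar>\<zeta> x\<bar> \<le> 1) \<and> periodic_fun_simple \<zeta> T \<and>
     (\<exists>S. finite S \<and> (\<forall>x\<in>{0<..<T} - S. isCont \<zeta> x))"

text \<open>On coefficients, differentiating \<open>L \<zeta>\<close> means multiplying by
  \<open>\<i> * \<Omega> * l \<Omega>\<close>, that is, by \<open>1 / L\<^sub>o\<close> plus the
  remainder \<open>\<rho>\<close>; \<open>h\<close> is the real part of the series that
  \<open>\<rho>\<close> produces. A derivative of a periodic function has no coefficient at
  frequency 0, hence the subtracted mean. The value 1/4 is the tolerance with which \<open>p\<close>
  is compared later.\<close>

lemma admissible_operator_increment:
  assumes T: "T > 0" and L: "admissible_operator T L"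
  obtains L\<^sub>o R d where "L\<^sub>o > 0" "R \<ge> 0" "d > 0"
    and "\<And>\<zeta>. wave_input T \<zeta> \<Longrightarrow>
      \<exists>h. continuous_on UNIV h \<and>
        (\<forall>a b. a \<le> b \<longrightarrow> L \<zeta> b - L \<zeta> a = integral {a..b} (\<lambda>x. (\<zeta> x - period_mean T \<zeta>) / L\<^sub>o + h x)) \<and>
        (\<forall>c x. \<bar>h x\<bar> \<le> R * integral {0..T} (\<lambda>x. \<bar>\<zeta> x - c\<bar>)) \<and>
        (\<forall>x y. \<bar>x - y\<bar> \<le> d \<longrightarrow> L\<^sub>o * \<bar>h x - h y\<bar> \<le> 1 / 4)"
proof -
  from L obtain l :: "real \<Rightarrow> complex" and L\<^sub>o d\<^sub>l :: real where
    L_cont: "\<And>\<zeta>. \<zeta> \<in> bounded_periodic T \<Longrightarrow> continuous_on UNIV (L \<zeta>)"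
    and L_per: "\<And>\<zeta>. \<zeta> \<in> bounded_periodic T \<Longrightarrow> periodic_fun_simple (L \<zeta>) T"
    and L_coeff: "\<And>\<zeta> n. \<zeta> \<in> bounded_periodic T \<Longrightarrow>
        fourier_coeff T (L \<zeta>) n = l (of_int n * (2 * pi / T)) * fourier_coeff T \<zeta> n"
    and Lo: "L\<^sub>o > 0" and dl: "d\<^sub>l \<ge> 2"
    and O: "(\<lambda>\<Omega>. \<i> * complex_of_real \<Omega> * l \<Omega> - complex_of_real (1 / L\<^sub>o))
             \<in> O[at_infinity](\<lambda>\<Omega>. complex_of_real (\<bar>\<Omega>\<bar> powr (- d\<^sub>l)))"
    unfolding admissible_operator_def by blast
  define w where "w = 2 * pi / T"
  have w: "w > 0" using T by (simp add: w_def)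
  define \<rho> where "\<rho> n = \<i> * complex_of_real (of_int n * w) * l (of_int n * w) - complex_of_real (1 / L\<^sub>o)" for n :: int
  have \<rho>: "(\<lambda>n. norm (\<rho> n)) summable_on UNIV"
    unfolding \<rho>_def by (rule summable_on_lattice_if_decay[OF w dl O])
  have pos: "1 / (4 * L\<^sub>o) > 0" using Lo by simp
  obtain R d where R: "R \<ge> 0" and d: "d > 0"
    and series: "\<And>z B t. \<forall>n. norm (z n) \<le> norm (\<rho> n) * B \<Longrightarrow>
      norm (\<Sum>\<^sub>\<infinity>n. z n * cis (of_int n * (2 * pi / T) * t)) \<le> R * B"
    "\<And>z s t. \<forall>n. norm (z n) \<le> norm (\<rho> n) \<Longrightarrow> \<bar>s - t\<bar> \<le> d \<Longrightarrow>
      norm ((\<Sum>\<^sub>\<infinity>n. z n * cis (of_int n * (2 * pi / T) * s))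
           - (\<Sum>\<^sub>\<infinity>n. z n * cis (of_int n * (2 * pi / T) * t))) \<le> 1 / (4 * L\<^sub>o)"
    by (rule fourier_series_bounds[OF T \<rho> pos]) (rule that, assumption+)
  show ?thesis
  proof (rule that[OF Lo _ d])
    show "R / T \<ge> 0" using R T by simp
    fix \<zeta> assume "wave_input T \<zeta>"
    then obtain S where \<zeta> [measurable]: "\<zeta> \<in> borel_measurable borel" and \<zeta>_le: "\<And>x. \<bar>\<zeta> x\<bar> \<le> 1"
      and \<zeta>_per: "periodic_fun_simple \<zeta> T"
      and S: "finite S" "\<And>x. x \<in> {0<..<T} - S \<Longrightarrow> isCont \<zeta> x"
      unfolding wave_input_def by blast
    have bp: "\<zeta> \<in> bounded_periodic T"
      unfolding bounded_periodic_def using \<zeta>_per \<zeta>_le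
      by (auto simp: bounded_iff intro!: measurable_completion)
    define z where "z n = fourier_coeff T \<zeta> n" for n
    \<comment> \<open>Frequency 0 is left out: the coefficient \<open>z 0\<close> is the mean of
      \<open>\<zeta>\<close>, which the distance of \<open>\<zeta>\<close> to constants does not
      control.\<close>
    define c where "c n = (if n = 0 then 0 else \<rho> n * z n)" for n
    have z_le: "norm (z n) \<le> integral {0..T} (\<lambda>x. \<bar>\<zeta> x - b\<bar>) / T" if "n \<noteq> 0" for n b
      unfolding z_def by (rule norm_fourier_coeff_le[OF T that \<zeta> \<zeta>_le])
    have int_abs: "(\<lambda>x. \<bar>\<zeta> x - b\<bar>) integrable_on {u..v}" for b u v
    proof (rule integrable_bounded_borel)
      show "norm \<bar>\<zeta> x - b\<bar> \<le> 1 + \<bar>b\<bar>" for x using \<zeta>_le[of x] by simp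
    qed simp
    have "integral {0..T} (\<lambda>x. \<bar>\<zeta> x - 0\<bar>) \<le> integral {0..T} (\<lambda>x. 1)"
      by (rule integral_le[OF int_abs]) (use \<zeta>_le in auto)
    then have z_le_1: "norm (z n) \<le> 1" if "n \<noteq> 0" for n
      using order_trans[OF z_le[OF that, of 0], of 1] T by simp
    have c_le: "\<forall>n. norm (c n) \<le> norm (\<rho> n)"
      using z_le_1 by (auto simp: c_def norm_mult mult_left_le)
    have c_sum: "(\<lambda>n. norm (c n)) summable_on UNIV"
      by (rule Infinite_Sum.abs_summable_on_comparison_test'[OF \<rho>]) (use c_le in simp)
    define H where "H t = (\<Sum>\<^sub>\<infinity>n. c n * cis (of_int n * (2 * pi / T) * t))" for t
    have H_cont: "continuous_on UNIV H"
      unfolding H_def by (rule continuous_on_fourier_series[OF T c_sum])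
    have H_coeff: "((\<lambda>t. H t * cis (- (of_int n * (2 * pi / T) * t))) has_integral T * c n) {0..T}" for n
      unfolding H_def by (rule fourier_series_has_integral[OF T c_sum])
    have H_per: "H (t + T) = H t" for t
      using cis_fourier_periodic[of T] T by (simp add: H_def)
    have H_mod: "norm (H s - H t) \<le> 1 / (4 * L\<^sub>o)" if "\<bar>s - t\<bar> \<le> d" for s t
      unfolding H_def by (rule series(2)[OF c_le that])
    have H_le: "norm (H t) \<le> R / T * integral {0..T} (\<lambda>x. \<bar>\<zeta> x - b\<bar>)" for b t
    proof -
      define B where "B = integral {0..T} (\<lambda>x. \<bar>\<zeta> x - b\<bar>) / T"
      have "\<forall>n. norm (c n) \<le> norm (\<rho> n) * B"
      proof
        fix n
        have "B \<ge> 0" unfolding B_def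
          using Henstock_Kurzweil_Integration.integral_nonneg[OF int_abs, of 0 T b] T by simp
        then show "norm (c n) \<le> norm (\<rho> n) * B"
          using mult_left_mono[OF z_le[of n b] norm_ge_zero[of "\<rho> n"]]
            mult_nonneg_nonneg[OF norm_ge_zero[of "\<rho> n"], of B]
          by (auto simp: c_def norm_mult B_def)
      qed
      then have "norm (H t) \<le> R * B" unfolding H_def by (rule series(1))
      also have "\<dots> \<le> R * (integral {0..T} (\<lambda>x. \<bar>\<zeta> x - b\<bar>) / T)"
        using R by (intro mult_left_mono) (simp add: B_def)
      finally show ?thesis by simp
    qed
    define m where "m = period_mean T \<zeta>"
    \<comment> \<open>The candidate for the derivative of \<open>L \<zeta>\<close>, of which only
      the real part will matter.\<close>
    define W where "W x = complex_of_real ((\<zeta> x - m) / L\<^sub>o) + H x" for x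
    have int_\<zeta>: "\<zeta> integrable_on {u..v}" for u v
      by (rule integrable_bounded_borel[of _ 1]) (simp_all add: \<zeta>_le)
    have [measurable]: "H \<in> borel_measurable borel"
      using H_cont by (rule borel_measurable_continuous_onI)
    obtain B where B: "\<And>x. norm (W x) \<le> B"
    proof
      fix x
      have "norm (W x) \<le> norm (complex_of_real ((\<zeta> x - m) / L\<^sub>o)) + norm (H x)"
        unfolding W_def by (rule norm_triangle_ineq)
      also have "norm (complex_of_real ((\<zeta> x - m) / L\<^sub>o)) \<le> (1 + \<bar>m\<bar>) / L\<^sub>o"
        unfolding norm_of_real using Lo \<zeta>_le[of x] by (auto simp: abs_div divide_right_mono)
      also have "norm (H x) \<le> R / T * integral {0..T} (\<lambda>x. \<bar>\<zeta> x - 0\<bar>)" by (rule H_le)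
      finally show "norm (W x) \<le> (1 + \<bar>m\<bar>) / L\<^sub>o + R / T * integral {0..T} (\<lambda>x. \<bar>\<zeta> x - 0\<bar>)" by simp
    qed
    have "\<And>a b. a \<le> b \<Longrightarrow> L \<zeta> b - L \<zeta> a = integral {a..b} (\<lambda>x. Re (W x))"
    proof (rule increment_eq_integral_if_fourier_coeffs[OF T])
      show "continuous_on UNIV (L \<zeta>)" by (rule L_cont[OF bp])
      interpret Lp: periodic_fun_simple "L \<zeta>" T by (rule L_per[OF bp])
      interpret \<zeta>: periodic_fun_simple \<zeta> T by (rule \<zeta>_per)
      show "L \<zeta> (t + T) = L \<zeta> t" for t by (rule Lp.plus_1)
      show "W integrable_on {a..b}" for a b
        by (rule integrable_bounded_borel[OF _ B]) (simp add: W_def)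
      show "norm (W x) \<le> B" for x by (rule B)
      show "periodic_fun_simple W T" by standard (simp add: W_def \<zeta>.plus_1 H_per)
      show "finite S" by (rule S)
      show "isCont W x" if "x \<in> {0<..<T} - S" for x
        unfolding W_def using S(2)[OF that] H_cont Lo
        by (intro continuous_intros) (auto simp: continuous_on_eq_continuous_at)
      have W_coeff: "((\<lambda>t. W t * cis (- (of_int n * (2 * pi / T) * t))) has_integral
          T * ((z n - (if n = 0 then m else 0)) / L\<^sub>o + c n)) {0..T}" for n
      proof -
        define e where "e t = cis (- (of_int n * (2 * pi / T) * t))" for t
        have "((\<lambda>t. complex_of_real (\<zeta> t) * e t) has_integral T * z n) {0..T}"
        proof -
          have [measurable]: "e \<in> borel_measurable borel"
            unfolding e_def using T by (intro borel_measurable_continuous_onI continuous_intros) auto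
          have norm_e: "norm (e t) = 1" for t by (simp add: e_def)
          have "(\<lambda>t. complex_of_real (\<zeta> t) * e t) integrable_on {0..T}"
            by (rule integrable_bounded_borel[of _ 1]) (simp_all add: norm_mult norm_e \<zeta>_le)
          then show ?thesis
            using T by (simp add: z_def fourier_coeff_def period_mean_def e_def scaleR_conv_of_real has_integral_integral)
        qed
        moreover have "(e has_integral (if n = 0 then of_real T else 0)) {0..T}"
        proof -
          have "e integrable_on {0..T}"
            unfolding e_def by (intro integrable_continuous_interval continuous_intros)
          moreover have "integral {0..T} e = (if n = 0 then of_real T else 0)"
            using integral_cis_eq_0[OF T, of "- n"] T by (auto simp: e_def[abs_def] scaleR_conv_of_real)
          ultimately show ?thesis by (metis has_integral_integral)
        qed
        ultimately have "((\<lambda>t. (complex_of_real (\<zeta> t) * e t - of_real m * e t) * (1 / L\<^sub>o) + H t * e t) has_integral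
            (T * z n - of_real m * (if n = 0 then of_real T else 0)) * (1 / L\<^sub>o) + T * c n) {0..T}"
          unfolding e_def
          by (intro has_integral_add has_integral_diff has_integral_mult_left has_integral_mult_right H_coeff)
        then show ?thesis
          by (rule has_integral_eq_rhs[OF has_integral_eq[rotated]])
            (auto simp: W_def e_def field_simps)
      qed
      have "z 0 = m"
        unfolding z_def m_def fourier_coeff_def period_mean_def
        using integral_linear[OF int_\<zeta> bounded_linear_of_real[where ?'a = complex], of 0 T]
        by (simp add: o_def scaleR_conv_of_real)
      then show "integral {0..T} W = 0"
        using W_coeff[of 0] by (simp add: c_def integral_unique)
      fix n :: int assume n: "n \<noteq> 0"
      \<comment> \<open>\<open>fourier_coeff\<close> integrates against the conjugate exponential,
        hence the index \<open>- n\<close>.\<close>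
      have "integral {0..T} (\<lambda>t. W t * cis (of_int n * (2 * pi / T) * t)) = T * (z (- n) / L\<^sub>o + c (- n))"
        using W_coeff[of "- n"] n by (simp add: integral_unique)
      also have "z (- n) / L\<^sub>o + c (- n) = z (- n) * (- (\<i> * (of_int n * w) * l (- (of_int n * w))))"
        using n by (simp add: c_def \<rho>_def algebra_simps)
      also have "\<dots> = - (\<i> * (of_int n * w)) * fourier_coeff T (L \<zeta>) (- n)"
        unfolding L_coeff[OF bp] by (simp add: z_def w_def)
      also have "T * \<dots> = - (\<i> * (of_int n * w)) * (T * fourier_coeff T (L \<zeta>) (- n))" by simp
      also have "T * fourier_coeff T (L \<zeta>) (- n)
          = integral {0..T} (\<lambda>t. complex_of_real (L \<zeta> t) * cis (of_int n * (2 * pi / T) * t))"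
        using T by (simp add: fourier_coeff_def period_mean_def scaleR_conv_of_real)
      finally show "integral {0..T} (\<lambda>t. W t * cis (of_int n * (2 * pi / T) * t))
       = - (\<i> * (of_int n * (2 * pi / T))) * integral {0..T} (\<lambda>t. complex_of_real (L \<zeta> t) * cis (of_int n * (2 * pi / T) * t))"
        by (simp add: w_def)
    qed
    moreover have "(\<lambda>x. Re (W x)) = (\<lambda>x. (\<zeta> x - m) / L\<^sub>o + Re (H x))" by (simp add: W_def fun_eq_iff)
    moreover have "L\<^sub>o * \<bar>Re (H s) - Re (H t)\<bar> \<le> 1 / 4" if "\<bar>s - t\<bar> \<le> d" for s t
    proof -
      have "\<bar>Re (H s) - Re (H t)\<bar> \<le> norm (H s - H t)" using abs_Re_le_cmod[of "H s - H t"] by simp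
      also have "\<dots> \<le> 1 / (4 * L\<^sub>o)" by (rule H_mod[OF that])
      finally show ?thesis using Lo by (simp add: field_simps)
    qed
    moreover have "\<bar>Re (H t)\<bar> \<le> R / T * integral {0..T} (\<lambda>x. \<bar>\<zeta> x - b\<bar>)" for t b
      using H_le[of t b] abs_Re_le_cmod[of "H t"] by linarith
    moreover have "continuous_on UNIV (\<lambda>t. Re (H t))" by (intro continuous_intros H_cont)
    ultimately show "\<exists>h. continuous_on UNIV h \<and>
        (\<forall>a b. a \<le> b \<longrightarrow> L \<zeta> b - L \<zeta> a = integral {a..b} (\<lambda>x. (\<zeta> x - period_mean T \<zeta>) / L\<^sub>o + h x)) \<and>
        (\<forall>c x. \<bar>h x\<bar> \<le> R / T * integral {0..T} (\<lambda>x. \<bar>\<zeta> x - c\<bar>)) \<and>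
        (\<forall>x y. \<bar>x - y\<bar> \<le> d \<longrightarrow> L\<^sub>o * \<bar>h x - h y\<bar> \<le> 1 / 4)"
      by (intro exI[of _ "\<lambda>t. Re (H t)"]) (simp add: m_def)
  qed
qed

section \<open>Zeros and signs\<close>

lemma integral_mean_value:
  fixes q :: "real \<Rightarrow> real"
  assumes "u < v" and cont: "continuous_on {u..v} q"
  obtains y where "y \<in> {u..v}" "integral {u..v} q = (v - u) * q y"
proof -
  have "((\<lambda>x. integral {u..x} q) has_derivative (\<lambda>z. z * q x)) (at x within {u..v})" if "u \<le> x" "x \<le> v" for x
    using integral_has_real_derivative[OF cont, of x] that
    by (simp add: has_field_derivative_def mult_commute_abs)
  then obtain y where "y \<in> {u<..<v}" "integral {u..v} q - integral {u..u} q = (v - u) * q y"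
    using mvt_simple[OF \<open>u < v\<close>, of "\<lambda>x. integral {u..x} q" "\<lambda>x z. z * q x"] by auto
  then show ?thesis by (intro that[of y]) auto
qed

lemma sgn_eq_if_no_zero_between:
  fixes f :: "real \<Rightarrow> real"
  assumes cont: "continuous_on UNIV f" and no0: "\<And>x. x \<in> {a<..<b} \<Longrightarrow> f x \<noteq> 0"
    and xy: "x \<in> {a<..<b}" "y \<in> {a<..<b}"
  shows "sgn (f x) = sgn (f y)"
proof -
  have "connected (f ` {a<..<b})"
    by (intro connected_continuous_image continuous_on_subset[OF cont]) auto
  moreover have "f x \<in> f ` {a<..<b}" "f y \<in> f ` {a<..<b}" using xy by auto
  ultimately have "z \<in> f ` {a<..<b}" if "min (f x) (f y) \<le> z" "z \<le> max (f x) (f y)" for z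
    using that unfolding connected_iff_interval by (auto simp: min_def max_def split: if_splits)
  from this[of 0] have "\<not> (min (f x) (f y) \<le> 0 \<and> 0 \<le> max (f x) (f y))"
    using no0 by force
  then show ?thesis by (auto simp: sgn_if min_def max_def split: if_splits)
qed

text \<open>The minimum over a window is at most the average there. This turns an L^1 bound into a
  point of small value at a prescribed place.\<close>

lemma periodic_small_value:
  fixes F :: "real \<Rightarrow> real"
  assumes T: "T > 0" and cont: "continuous_on UNIV F" and per: "periodic_fun_simple F T"
    and \<eta>: "0 < \<eta>" "\<eta> \<le> T"
  obtains u where "u \<in> {a..a + \<eta>}" "\<bar>F u\<bar> \<le> integral {0..T} (\<lambda>x. \<bar>F x\<bar>) / \<eta>"
proof -
  interpret periodic_fun_simple F T by (rule per)
  have cont': "continuous_on A (\<lambda>x. \<bar>F x\<bar>)" for A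
    by (intro continuous_intros continuous_on_subset[OF cont]) auto
  note int = integrable_continuous_interval[OF cont']
  obtain u where u: "u \<in> {a..a + \<eta>}" "\<And>x. x \<in> {a..a + \<eta>} \<Longrightarrow> \<bar>F u\<bar> \<le> \<bar>F x\<bar>"
    using continuous_attains_inf[OF _ _ cont', of "{a..a + \<eta>}"] \<eta> by force
  have "\<bar>F u\<bar> * \<eta> = integral {a..a + \<eta>} (\<lambda>x. \<bar>F u\<bar>)" using \<eta> by simp
  also have "\<dots> \<le> integral {a..a + \<eta>} (\<lambda>x. \<bar>F x\<bar>)" by (rule integral_le[OF _ int]) (use u in auto)
  also have "\<dots> \<le> integral {a..a + T} (\<lambda>x. \<bar>F x\<bar>)"
    by (rule integral_subset_le[OF _ int int]) (use \<eta> in auto)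
  also have "\<dots> = integral {0..T} (\<lambda>x. \<bar>F x\<bar>)"
    by (rule integral_shift_periodic[OF T _ int]) (standard, simp add: plus_1)
  finally show ?thesis using that[OF u(1)] \<eta> by (simp add: field_simps)
qed

section \<open>Zeros of a labelled periodic function\<close>

context
  fixes T :: real and f :: "real \<Rightarrow> real" and m :: nat and t :: "nat \<Rightarrow> real"
  assumes T: "T > 0" and per: "periodic_fun_simple f T" and lab: "zero_labelling T f m t"
begin

lemma zero_labelling_pos: "m > 0"
  using T lab unfolding zero_labelling_def by (cases "m = 0") auto

lemma zero_labelling_mono: 
  assumes "1 \<le> i" "i \<le> j" "j \<le> Suc m"
  shows "t i \<le> t j"
  using assms(2,3)
proof (induction rule: dec_induct)
  case (step n)
  then have "t n < t (Suc n)" using lab assms(1) unfolding zero_labelling_def by auto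
  with step show ?case by simp
qed simp

lemma zero_labelling_no_zero:
  assumes k: "k \<in> {1..m}" and x: "x \<in> {t k<..<t (Suc k)}"
  shows "f x \<noteq> 0"
proof
  assume "f x = 0"
  moreover have "t 1 \<le> t k" "t (Suc k) \<le> t (Suc m)" using k by (auto intro!: zero_labelling_mono)
  ultimately have "x \<in> {s \<in> {t 1..<t 1 + T}. f s = 0}"
    using x lab unfolding zero_labelling_def by auto
  moreover have "{s \<in> {t 1..<t 1 + T}. f s = 0} = t ` {1..m}"
    using lab unfolding zero_labelling_def by blast
  ultimately obtain j where j: "j \<in> {1..m}" "x = t j" by blast
  have "t j \<le> t k" if "j \<le> k" using zero_labelling_mono[of j k] that k j by auto
  moreover have "t (Suc k) \<le> t j" if "Suc k \<le> j" using zero_labelling_mono[of "Suc k" j] that k j by auto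
  ultimately show False using x j by (cases "j \<le> k") auto
qed

text \<open>Every zero is a labelled one moved by a multiple of \<open>T\<close>, and two zeros less
  than \<open>T\<close> apart cannot come from the same label. So the labels count the zeros in a
  period with any starting point.\<close>

lemma zeros_in_period:
  "finite {s \<in> {x..<x + T}. f s = 0}" "card {s \<in> {x..<x + T}. f s = 0} \<le> m"
proof -
  interpret periodic_fun_simple f T by (rule per)
  have "\<exists>k\<in>{1..m}. \<exists>n::int. s = t k + of_int n * T" if "f s = 0" for s
  proof -
    define n where "n = \<lfloor>(s - t 1) / T\<rfloor>"
    have "of_int n \<le> (s - t 1) / T" "(s - t 1) / T < of_int n + 1" unfolding n_def by linarith+
    then have "s - of_int n * T \<in> {t 1..<t 1 + T}" using T by (auto simp: field_simps)
    moreover have "f (s - of_int n * T) = 0" using that minus_of_int by simp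
    ultimately have "s - of_int n * T \<in> t ` {1..m}" using lab unfolding zero_labelling_def by blast
    then obtain k where "k \<in> {1..m}" "s - of_int n * T = t k" by blast
    then show ?thesis by (intro bexI[of _ k] exI[of _ n]) auto
  qed
  then obtain \<kappa> \<nu> where \<kappa>: "\<And>s. f s = 0 \<Longrightarrow> \<kappa> s \<in> {1..m} \<and> s = t (\<kappa> s) + of_int (\<nu> s :: int) * T"
    by metis
  have inj: "inj_on \<kappa> {s \<in> {x..<x + T}. f s = 0}"
  proof (rule inj_onI)
    fix r s assume r: "r \<in> {s \<in> {x..<x + T}. f s = 0}" and s: "s \<in> {s \<in> {x..<x + T}. f s = 0}" and eq: "\<kappa> r = \<kappa> s"
    have "r - s = of_int (\<nu> r - \<nu> s) * T"
      using \<kappa>[of r] \<kappa>[of s] r s eq by (simp add: algebra_simps)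
    moreover have "\<bar>r - s\<bar> < T" using r s by auto
    ultimately have "real_of_int \<bar>\<nu> r - \<nu> s\<bar> * T < 1 * T"
      using T by (simp add: abs_mult)
    then have "\<bar>\<nu> r - \<nu> s\<bar> < 1" using T by (metis mult_less_cancel_right_pos of_int_less_1_iff)
    then show "r = s" using \<open>r - s = of_int (\<nu> r - \<nu> s) * T\<close> by simp
  qed
  have sub: "\<kappa> ` {s \<in> {x..<x + T}. f s = 0} \<subseteq> {1..m}" using \<kappa> by auto
  show "finite {s \<in> {x..<x + T}. f s = 0}" by (rule inj_on_finite[OF inj sub]) simp
  show "card {s \<in> {x..<x + T}. f s = 0} \<le> m" using card_inj_on_le[OF inj sub] by simp
qed

lemma wave_input_sgn:
  assumes cont: "continuous_on UNIV f"
  shows "wave_input T (\<lambda>x. sgn (f x))"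
  unfolding wave_input_def
proof (intro conjI exI allI ballI)
  interpret periodic_fun_simple f T by (rule per)
  have [measurable]: "f \<in> borel_measurable borel" using cont by (rule borel_measurable_continuous_onI)
  show "(\<lambda>x. sgn (f x)) \<in> borel_measurable borel" by measurable
  show "\<bar>sgn (f x)\<bar> \<le> 1" for x by (simp add: sgn_if)
  show "periodic_fun_simple (\<lambda>x. sgn (f x)) T" by standard (simp add: plus_1)
  show "finite {s \<in> {0..<0 + T}. f s = 0}" by (rule zeros_in_period)
  show "isCont (\<lambda>x. sgn (f x)) x" if "x \<in> {0<..<T} - {s \<in> {0..<0 + T}. f s = 0}" for x
    using that cont by (intro continuous_intros) (auto simp: continuous_on_eq_continuous_at)
qed

text \<open>Pigeonhole: \<open>m + 1\<close> disjoint windows of length \<epsilon> fit into one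
  period, which has at most \<open>m\<close> zeros, so one window is free of zeros.\<close>

lemma constant_sign_subinterval:
  assumes cont: "continuous_on UNIV f" and \<epsilon>: "\<epsilon> > 0" "real (m + 1) * \<epsilon> \<le> T"
  obtains a \<sigma> where "x \<le> a" "a + \<epsilon> \<le> x + real (m + 1) * \<epsilon>" "\<bar>\<sigma>\<bar> = 1" "\<And>y. y \<in> {a<..<a + \<epsilon>} \<Longrightarrow> sgn (f y) = \<sigma>"
proof -
  have "\<exists>j\<le>m. \<forall>y\<in>{x + real j * \<epsilon><..<x + real j * \<epsilon> + \<epsilon>}. f y \<noteq> 0"
  proof (rule ccontr)
    assume "\<not> ?thesis"
    then obtain s where s: "\<And>j. j \<le> m \<Longrightarrow> x + real j * \<epsilon> < s j \<and> s j < x + real j * \<epsilon> + \<epsilon> \<and> f (s j) = 0"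
      by (metis greaterThanLessThan_iff)
    have s_less: "s i < s j" if "i < j" "j \<le> m" for i j
    proof -
      have "s i < x + real (Suc i) * \<epsilon>" using s[of i] that by (simp add: algebra_simps)
      also have "\<dots> \<le> x + real j * \<epsilon>" using that \<epsilon> by (intro add_left_mono mult_right_mono) auto
      also have "\<dots> < s j" using s that by simp
      finally show ?thesis .
    qed
    have "inj_on s {..m}"
      by (rule linorder_inj_onI) (use s_less in \<open>auto, fastforce\<close>)
    moreover have "s ` {..m} \<subseteq> {s \<in> {x..<x + T}. f s = 0}"
    proof (intro image_subsetI)
      fix j assume j: "j \<in> {..m}"
      have "0 \<le> real j * \<epsilon>" "real j * \<epsilon> \<le> real m * \<epsilon>" using j \<epsilon> by auto
      moreover have "real (m + 1) * \<epsilon> = real m * \<epsilon> + \<epsilon>" by (simp add: algebra_simps)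
      moreover have "x + real j * \<epsilon> < s j \<and> s j < x + real j * \<epsilon> + \<epsilon>" using s j by blast
      ultimately have "x \<le> s j" "s j < x + real (m + 1) * \<epsilon>" by linarith+
      then show "s j \<in> {s \<in> {x..<x + T}. f s = 0}" using s[of j] j \<epsilon> by auto
    qed
    ultimately have "card {..m} \<le> card {s \<in> {x..<x + T}. f s = 0}"
      by (intro card_inj_on_le zeros_in_period)
    then show False using zeros_in_period(2)[of x] by simp
  qed
  then obtain j where j: "j \<le> m" "\<And>y. y \<in> {x + real j * \<epsilon><..<x + real j * \<epsilon> + \<epsilon>} \<Longrightarrow> f y \<noteq> 0" by blast
  define a where "a = x + real j * \<epsilon>"
  have "real j * \<epsilon> \<le> real m * \<epsilon>" using j \<epsilon> by auto
  show ?thesis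
  proof (rule that[of a "sgn (f (a + \<epsilon> / 2))"])
    show "x \<le> a" using \<epsilon> by (simp add: a_def)
    show "a + \<epsilon> \<le> x + real (m + 1) * \<epsilon>" using \<open>real j * \<epsilon> \<le> real m * \<epsilon>\<close> by (simp add: a_def algebra_simps)
    have "f (a + \<epsilon> / 2) \<noteq> 0" using j(2)[of "a + \<epsilon> / 2"] \<epsilon> by (simp add: a_def)
    then show "\<bar>sgn (f (a + \<epsilon> / 2))\<bar> = 1" by (simp add: sgn_if)
    fix y assume "y \<in> {a<..<a + \<epsilon>}"
    then show "sgn (f y) = sgn (f (a + \<epsilon> / 2))"
      using \<epsilon> j(2) by (intro sgn_eq_if_no_zero_between[OF cont, of a "a + \<epsilon>"]) (auto simp: a_def)
  qed
qed

end

section \<open>Uniform continuity and boundedness of continuous periodic functions\<close>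

lemma periodic_uniformly_continuous:
  fixes F :: "real \<Rightarrow> real"
  assumes T: "T > 0" and cont: "continuous_on UNIV F" and per: "periodic_fun_simple F T" and e: "e > 0"
  obtains d where "d > 0" "\<And>x y. \<bar>x - y\<bar> < d \<Longrightarrow> \<bar>F x - F y\<bar> < e"
proof -
  interpret periodic_fun_simple F T by (rule per)
  \<comment> \<open>One extra period on either side: only \<open>x\<close> is reduced to the basic
    period, and \<open>y\<close> follows at a distance less than \<open>T\<close>.\<close>
  have "uniformly_continuous_on {-T..2 * T} F"
    by (intro compact_uniformly_continuous continuous_on_subset[OF cont]) auto
  then obtain d where d: "d > 0" "\<And>x y. x \<in> {-T..2 * T} \<Longrightarrow> y \<in> {-T..2 * T} \<Longrightarrow> \<bar>x - y\<bar> < d \<Longrightarrow> \<bar>F x - F y\<bar> < e"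
    using e unfolding uniformly_continuous_on_def dist_real_def by metis
  show ?thesis
  proof (rule that)
    show "min d T > 0" using d T by simp
    fix x y :: real assume xy: "\<bar>x - y\<bar> < min d T"
    define n where "n = \<lfloor>x / T\<rfloor>"
    have "of_int n \<le> x / T" "x / T < of_int n + 1" unfolding n_def by linarith+
    then have "0 \<le> x - of_int n * T" "x - of_int n * T < T" using T by (auto simp: field_simps)
    then have "\<bar>F (x - of_int n * T) - F (y - of_int n * T)\<bar> < e"
      using xy by (intro d(2)) auto
    then show "\<bar>F x - F y\<bar> < e" by (simp add: minus_of_int)
  qed
qed

section \<open>Square-wave solutions\<close>

lemma periodic_bounded:
  fixes F :: "real \<Rightarrow> real"
  assumes T: "T > 0" and cont: "continuous_on UNIV F" and per: "periodic_fun_simple F T"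
  obtains M where "M > 0" "\<And>x. \<bar>F x\<bar> \<le> M"
proof -
  interpret periodic_fun_simple F T by (rule per)
  have "bounded (F ` {0..T})"
    by (intro compact_imp_bounded compact_continuous_image continuous_on_subset[OF cont]) auto
  then obtain M where M: "M > 0" "\<And>x. x \<in> {0..T} \<Longrightarrow> \<bar>F x\<bar> \<le> M"
    unfolding bounded_pos by auto
  show ?thesis
  proof (rule that[OF M(1)])
    fix x
    define n where "n = \<lfloor>x / T\<rfloor>"
    have "of_int n \<le> x / T" "x / T < of_int n + 1" unfolding n_def by linarith+
    then have "x - of_int n * T \<in> {0..T}" using T by (auto simp: field_simps)
    then show "\<bar>F x\<bar> \<le> M" using M(2)[of "x - of_int n * T"] by (simp add: minus_of_int)
  qed
qed

text \<open>\<open>g\<close> stands for \<open>L (sgn f)\<close>, and \<open>h\<close> for \<open>g' - (sgn f - period_mean T (sgn f)) / L\<^sub>o\<close>.\<close>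

locale wave_solution =
  fixes T L\<^sub>o R d \<mu> :: real and m :: nat and \<phi> f g h :: "real \<Rightarrow> real" and t :: "nat \<Rightarrow> real"
  assumes T: "T > 0" and L\<^sub>o: "L\<^sub>o > 0" and R: "R \<ge> 0" and \<mu>: "\<mu> > 0"
    and \<phi>_cont: "continuous_on UNIV \<phi>" and \<phi>_per: "periodic_fun_simple \<phi> T" and \<phi>_mean: "integral {0..T} \<phi> = 0"
    and f_cont: "continuous_on UNIV f" and f_per: "periodic_fun_simple f T"
    and g_cont: "continuous_on UNIV g" and g_per: "periodic_fun_simple g T" and g_mean: "integral {0..T} g = 0"
    and f_eq: "\<And>x. f x = \<phi> x - \<mu> * g x"
    and lab: "zero_labelling T f m t"
    and lossless: "integral {0..T} (\<lambda>x. sgn (f x) * g x) = 0"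
    and h_cont: "continuous_on UNIV h"
    and increment: "\<And>a b. a \<le> b \<Longrightarrow>
      g b - g a = integral {a..b} (\<lambda>x. (sgn (f x) - period_mean T (\<lambda>x. sgn (f x))) / L\<^sub>o + h x)"
    and h_le: "\<And>c x. \<bar>h x\<bar> \<le> R * integral {0..T} (\<lambda>x. \<bar>sgn (f x) - c\<bar>)"
    and h_mod: "\<And>x y. \<bar>x - y\<bar> \<le> d \<Longrightarrow> L\<^sub>o * \<bar>h x - h y\<bar> \<le> 1 / 4"
begin

text \<open>Reduces the case of a mostly negative \<open>f\<close> to that of a mostly positive one.
  The bound \<open>h_le\<close> survives because its constant \<open>c\<close> is arbitrary, so that
  \<open>- c\<close> can take its place.\<close>

lemma wave_solution_uminus:
  "wave_solution T L\<^sub>o R d \<mu> m (\<lambda>x. - \<phi> x) (\<lambda>x. - f x) (\<lambda>x. - g x) (\<lambda>x. - h x) t"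
proof
  show "zero_labelling T (\<lambda>x. - f x) m t" using lab by (simp add: zero_labelling_def)
  interpret \<phi>: periodic_fun_simple \<phi> T by (rule \<phi>_per)
  interpret f: periodic_fun_simple f T by (rule f_per)
  interpret g: periodic_fun_simple g T by (rule g_per)
  show "- \<phi> (x + T) = - \<phi> x" "- f (x + T) = - f x" "- g (x + T) = - g x" for x
    by (simp_all add: \<phi>.plus_1 f.plus_1 g.plus_1)
  show "continuous_on UNIV (\<lambda>x. - \<phi> x)" "continuous_on UNIV (\<lambda>x. - f x)"
    "continuous_on UNIV (\<lambda>x. - g x)" "continuous_on UNIV (\<lambda>x. - h x)"
    by (intro continuous_intros \<phi>_cont f_cont g_cont h_cont)+
  show "integral {0..T} (\<lambda>x. - \<phi> x) = 0" "integral {0..T} (\<lambda>x. - g x) = 0"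
    by (simp_all add: \<phi>_mean g_mean)
  show "integral {0..T} (\<lambda>x. sgn (- f x) * - g x) = 0" by (simp add: sgn_minus lossless)
  show "- f x = - \<phi> x - \<mu> * - g x" for x by (simp add: f_eq)
  show "\<bar>- h x\<bar> \<le> R * integral {0..T} (\<lambda>x. \<bar>sgn (- f x) - c\<bar>)" for c x
  proof -
    have "(\<lambda>x. \<bar>sgn (- f x) - c\<bar>) = (\<lambda>x. \<bar>sgn (f x) - - c\<bar>)"
      by (auto simp: sgn_minus fun_eq_iff)
    then show ?thesis using h_le[of x "- c"] by simp
  qed
  show "L\<^sub>o * \<bar>- h x - - h y\<bar> \<le> 1 / 4" if "\<bar>x - y\<bar> \<le> d" for x y
    using h_mod[OF that] by (simp add: abs_minus_commute)
  show "- g b - - g a = integral {a..b} (\<lambda>x. (sgn (- f x) - period_mean T (\<lambda>x. sgn (- f x))) / L\<^sub>o + - h x)"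
    if "a \<le> b" for a b
  proof -
    have "(\<lambda>x. (sgn (- f x) - period_mean T (\<lambda>x. sgn (- f x))) / L\<^sub>o + - h x)
       = (\<lambda>x. - ((sgn (f x) - period_mean T (\<lambda>x. sgn (f x))) / L\<^sub>o + h x))"
      using L\<^sub>o by (simp add: sgn_minus period_mean_def fun_eq_iff field_simps)
    then have "integral {a..b} (\<lambda>x. (sgn (- f x) - period_mean T (\<lambda>x. sgn (- f x))) / L\<^sub>o + - h x)
       = - integral {a..b} (\<lambda>x. (sgn (f x) - period_mean T (\<lambda>x. sgn (f x))) / L\<^sub>o + h x)"
      by (simp only: integral_neg)
    then show ?thesis using increment[OF that] by linarith
  qed
qed (use T L\<^sub>o R \<mu> in auto)

section \<open>L^1 bounds from losslessness\<close>

abbreviation "\<zeta> x \<equiv> sgn (f x)"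

definition "\<zeta>_mean = period_mean T \<zeta>"

lemma f_meas [measurable]: "f \<in> borel_measurable borel"
  by (rule borel_measurable_continuous_onI[OF f_cont])

lemma continuous_intervals [simp]:
  "continuous_on A f" "continuous_on A g" "continuous_on A h" "continuous_on A \<phi>"
  by (rule continuous_on_subset[OF _ subset_UNIV], rule f_cont g_cont h_cont \<phi>_cont)+

lemma \<zeta>_le: "\<bar>\<zeta> x\<bar> \<le> 1"
  by (simp add: sgn_if)

lemma integrable_\<zeta>_mult:
  assumes "continuous_on UNIV F" "periodic_fun_simple F T"
  shows "(\<lambda>x. \<zeta> x * F x) integrable_on {a..b}"
proof -
  obtain M where M: "M > 0" "\<And>x. \<bar>F x\<bar> \<le> M" using periodic_bounded[OF T assms] by blast
  have [measurable]: "F \<in> borel_measurable borel" by (rule borel_measurable_continuous_onI[OF assms(1)])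
  have "\<bar>\<zeta> x * F x\<bar> \<le> M" for x
    using mult_mono[OF \<zeta>_le M(2), of x x] by (simp add: abs_mult)
  then show ?thesis by (intro integrable_bounded_borel[of _ M]) auto
qed

lemma integrable_\<zeta> [simp]: "\<zeta> integrable_on {a..b}"
  by (rule integrable_bounded_borel[of _ 1]) (use \<zeta>_le in auto)

text \<open>When the equation for \<open>f\<close> is multiplied by \<open>\<zeta>\<close>, the term
  with \<open>g\<close> is exactly the one that \<open>lossless\<close> annihilates.\<close>

lemma integral_abs_f: "integral {0..T} (\<lambda>x. \<bar>f x\<bar>) = integral {0..T} (\<lambda>x. \<zeta> x * \<phi> x)"
proof -
  have "\<bar>f x\<bar> = (\<phi> x - \<mu> * g x) * \<zeta> x" for x
    using abs_sgn[of "f x"] by (simp flip: f_eq)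
  then have "(\<lambda>x. \<bar>f x\<bar>) = (\<lambda>x. \<zeta> x * \<phi> x - \<mu> * (\<zeta> x * g x))"
    by (simp add: fun_eq_iff algebra_simps)
  then show ?thesis
    using lossless by (simp add: integral_diff integrable_\<zeta>_mult \<phi>_cont \<phi>_per g_cont g_per integrable_on_mult_right)
qed

lemma integral_abs_f_le: "integral {0..T} (\<lambda>x. \<bar>f x\<bar>) \<le> integral {0..T} (\<lambda>x. \<bar>\<phi> x\<bar>)"
  unfolding integral_abs_f
proof (rule integral_le)
  fix x
  have "\<zeta> x * \<phi> x \<le> \<bar>\<zeta> x\<bar> * \<bar>\<phi> x\<bar>" by (metis abs_ge_self abs_mult)
  also have "\<dots> \<le> 1 * \<bar>\<phi> x\<bar>" by (intro mult_right_mono \<zeta>_le) simp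
  finally show "\<zeta> x * \<phi> x \<le> \<bar>\<phi> x\<bar>" by simp
next
  show "(\<lambda>x. \<bar>\<phi> x\<bar>) integrable_on {0..T}"
    by (intro integrable_continuous_interval continuous_intros) simp
qed (rule integrable_\<zeta>_mult[OF \<phi>_cont \<phi>_per])

lemma integral_abs_g_le: "\<mu> * integral {0..T} (\<lambda>x. \<bar>g x\<bar>) \<le> 2 * integral {0..T} (\<lambda>x. \<bar>\<phi> x\<bar>)"
proof -
  have "\<mu> * integral {0..T} (\<lambda>x. \<bar>g x\<bar>) = integral {0..T} (\<lambda>x. \<mu> * \<bar>g x\<bar>)" by simp
  also have "\<dots> \<le> integral {0..T} (\<lambda>x. \<bar>\<phi> x\<bar> + \<bar>f x\<bar>)"
  proof (rule integral_le)
    fix x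
    have "\<mu> * \<bar>g x\<bar> = \<bar>\<phi> x - f x\<bar>" using \<mu> f_eq by (simp add: abs_mult)
    then show "\<mu> * \<bar>g x\<bar> \<le> \<bar>\<phi> x\<bar> + \<bar>f x\<bar>" by simp
  qed (auto intro!: integrable_continuous_interval continuous_intros)
  also have "\<dots> = integral {0..T} (\<lambda>x. \<bar>\<phi> x\<bar>) + integral {0..T} (\<lambda>x. \<bar>f x\<bar>)"
    by (rule integral_add) (auto intro!: integrable_continuous_interval continuous_intros)
  finally show ?thesis using integral_abs_f_le by simp
qed

text \<open>Choose points of small \<open>g\<close> in the first and the last third of the window;
  the mean slope of \<open>g\<close> between them is the value at some \<open>y\<close> of
  \<open>q\<close>, and \<open>L\<^sub>o * q\<close> is the quantity to be bounded. With
  \<open>G\<close> the L^1 norm of \<open>g\<close>, both values are at most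
  \<open>3 * G / \<epsilon>\<close> and the points are at least \<open>\<epsilon> / 3\<close> apart,
  so \<open>q\<close> is at most \<open>18 * G / \<epsilon>\<^sup>2\<close>. The bound on
  \<open>\<mu> * G\<close> doubles 18 to 36, and the tolerance 1/4 makes it 144.\<close>

lemma h_near_where_constant:
  assumes \<epsilon>: "0 < \<epsilon>" "\<epsilon> \<le> T" and \<sigma>: "\<And>x. x \<in> {a<..<a + \<epsilon>} \<Longrightarrow> \<zeta> x = \<sigma>"
    and large: "144 * L\<^sub>o * integral {0..T} (\<lambda>x. \<bar>\<phi> x\<bar>) \<le> \<mu> * \<epsilon>\<^sup>2"
  obtains y where "y \<in> {a..a + \<epsilon>}" "\<bar>\<sigma> - (\<zeta>_mean - L\<^sub>o * h y)\<bar> \<le> 1 / 4"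
proof -
  define G where "G = integral {0..T} (\<lambda>x. \<bar>g x\<bar>)"
  have \<epsilon>3: "0 < \<epsilon> / 3" "\<epsilon> / 3 \<le> T" using \<epsilon> by auto
  obtain u where u: "u \<in> {a..a + \<epsilon> / 3}" "\<bar>g u\<bar> \<le> G / (\<epsilon> / 3)"
    unfolding G_def by (rule periodic_small_value[OF T g_cont g_per \<epsilon>3])
  obtain v where v: "v \<in> {a + 2 * \<epsilon> / 3..a + 2 * \<epsilon> / 3 + \<epsilon> / 3}" "\<bar>g v\<bar> \<le> G / (\<epsilon> / 3)"
    unfolding G_def by (rule periodic_small_value[OF T g_cont g_per \<epsilon>3])
  have uv: "u < v" "\<epsilon> / 3 \<le> v - u" "v \<le> a + \<epsilon>" "a \<le> u" using u v \<epsilon> by auto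
  define q where "q x = (\<sigma> - \<zeta>_mean) / L\<^sub>o + h x" for x
  have "continuous_on {u..v} q" unfolding q_def using L\<^sub>o by (intro continuous_intros) auto
  then obtain y where y: "y \<in> {u..v}" "integral {u..v} q = (v - u) * q y"
    using integral_mean_value[OF uv(1)] by blast
  have "g v - g u = integral {u..v} (\<lambda>x. (\<zeta> x - \<zeta>_mean) / L\<^sub>o + h x)"
    using increment[of u v] uv by (simp add: \<zeta>_mean_def)
  also have "\<dots> = integral {u..v} q"
    by (rule integral_spike[of "{a, a + \<epsilon>}"]) (use uv \<sigma> in \<open>auto simp: q_def\<close>)
  finally have "(v - u) * \<bar>q y\<bar> = \<bar>g v - g u\<bar>"
    using y(2) uv by (simp add: abs_mult)
  also have "\<dots> \<le> 6 * G / \<epsilon>" using u(2) v(2) by (simp add: abs_if split: if_splits)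
  finally have "\<epsilon> / 3 * \<bar>q y\<bar> \<le> 6 * G / \<epsilon>"
    using mult_right_mono[OF uv(2), of "\<bar>q y\<bar>"] by simp
  then have "\<epsilon>\<^sup>2 * \<bar>q y\<bar> \<le> 18 * G" using \<epsilon> by (simp add: field_simps power2_eq_square)
  then have "\<mu> * (\<epsilon>\<^sup>2 * \<bar>q y\<bar>) \<le> \<mu> * (18 * G)" using \<mu> by (intro mult_left_mono) auto
  also have "\<dots> \<le> 36 * integral {0..T} (\<lambda>x. \<bar>\<phi> x\<bar>)"
    using integral_abs_g_le by (simp add: G_def)
  finally have *: "\<mu> * \<epsilon>\<^sup>2 * \<bar>q y\<bar> \<le> 36 * integral {0..T} (\<lambda>x. \<bar>\<phi> x\<bar>)" by simp
  have "\<sigma> - (\<zeta>_mean - L\<^sub>o * h y) = L\<^sub>o * q y" using L\<^sub>o by (simp add: q_def field_simps)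
  then have "\<mu> * \<epsilon>\<^sup>2 * (4 * \<bar>\<sigma> - (\<zeta>_mean - L\<^sub>o * h y)\<bar>) = (\<mu> * \<epsilon>\<^sup>2 * \<bar>q y\<bar>) * (4 * L\<^sub>o)"
    using L\<^sub>o by (simp add: abs_mult)
  also have "\<dots> \<le> 36 * integral {0..T} (\<lambda>x. \<bar>\<phi> x\<bar>) * (4 * L\<^sub>o)"
    using L\<^sub>o by (intro mult_right_mono *) auto
  also have "\<dots> \<le> \<mu> * \<epsilon>\<^sup>2 * 1" using large by (simp add: mult_ac)
  finally have "4 * \<bar>\<sigma> - (\<zeta>_mean - L\<^sub>o * h y)\<bar> \<le> 1"
    using \<mu> \<epsilon> by (subst (asm) mult_le_cancel_left_pos) auto
  moreover have "y \<in> {a..a + \<epsilon>}" using y uv by auto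
  ultimately show ?thesis by (intro that[of y]) auto
qed

lemma one_sign_dominates:
  assumes \<epsilon>: "0 < \<epsilon>" "real (m + 1) * \<epsilon> \<le> T" "real (m + 1) * \<epsilon> \<le> d"
    and large: "144 * L\<^sub>o * integral {0..T} (\<lambda>x. \<bar>\<phi> x\<bar>) \<le> \<mu> * \<epsilon>\<^sup>2"
  shows "(\<forall>a. \<exists>x\<in>{a<..<a + \<epsilon>}. \<zeta> x \<noteq> - 1) \<or> (\<forall>a. \<exists>x\<in>{a<..<a + \<epsilon>}. \<zeta> x \<noteq> 1)"
proof -
  define p where "p x = \<zeta>_mean - L\<^sub>o * h x" for x
  have "0 \<le> real m * \<epsilon>" using \<epsilon> by simp
  then have \<epsilon>T: "\<epsilon> \<le> T" using \<epsilon>(2) by (simp add: algebra_simps)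
  note near = h_near_where_constant[OF \<epsilon>(1) \<epsilon>T _ large, folded p_def]
  \<comment> \<open>Within distance \<open>(m + 1) * \<epsilon>\<close> of \<open>x\<close> there is
    a \<open>y\<close> where \<open>p\<close> is within 1/4 of 1 or of -1, and \<open>p\<close>
    varies by at most 1/4 from \<open>x\<close> to \<open>y\<close>. So the modulus of
    \<open>p x\<close> is in fact at least 1/2.\<close>
  have p_far: "\<bar>p x\<bar> > 1 / 4" for x
  proof (rule ccontr)
    assume small: "\<not> \<bar>p x\<bar> > 1 / 4"
    obtain a \<sigma> where a: "x \<le> a" "a + \<epsilon> \<le> x + real (m + 1) * \<epsilon>" "\<bar>\<sigma>\<bar> = 1"
        "\<And>y. y \<in> {a<..<a + \<epsilon>} \<Longrightarrow> sgn (f y) = \<sigma>"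
      by (rule constant_sign_subinterval[OF T f_per lab f_cont \<epsilon>(1,2), where x = x])
        (rule that, assumption+)
    obtain y where y: "y \<in> {a..a + \<epsilon>}" "\<bar>\<sigma> - p y\<bar> \<le> 1 / 4"
      by (rule near[of a \<sigma>]) (use a in auto)
    have "L\<^sub>o * \<bar>h y - h x\<bar> \<le> 1 / 4" using y a \<epsilon> by (intro h_mod) auto
    then have "\<bar>p y - p x\<bar> \<le> 1 / 4"
      using L\<^sub>o abs_mult[of L\<^sub>o "h x - h y"] by (simp add: p_def right_diff_distrib abs_minus_commute)
    then show False using small y a(3) by linarith
  qed
  have p_cont: "continuous_on A p" for A unfolding p_def by (intro continuous_intros) auto
  have "(\<forall>x. p x > 1 / 4) \<or> (\<forall>x. p x < - 1 / 4)"
  proof (rule ccontr)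
    assume "\<not> ?thesis"
    then obtain x y where "\<not> p x > 1 / 4" "\<not> p y < - 1 / 4" by blast
    then have "p x < 0" "p y > 0" using p_far[of x] p_far[of y] by linarith+
    moreover have "p z \<noteq> 0" for z using p_far[of z] by auto
    then have "sgn (p x) = sgn (p y)"
      by (intro sgn_eq_if_no_zero_between[of p "min x y - 1" "max x y + 1"] p_cont) auto
    ultimately show False by (simp add: sgn_if)
  qed
  then show ?thesis
  proof
    assume p: "\<forall>x. p x > 1 / 4"
    \<comment> \<open>A window of sign -1 would contain a point where \<open>p\<close> is at most
      -3/4.\<close>
    have "\<exists>x\<in>{a<..<a + \<epsilon>}. \<zeta> x \<noteq> - 1" for a
    proof (rule ccontr)
      assume "\<not> ?thesis"
      then obtain y where "\<bar>- 1 - p y\<bar> \<le> 1 / 4" by (metis near)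
      then show False using p[rule_format, of y] by linarith
    qed
    then show ?thesis by blast
  next
    assume p: "\<forall>x. p x < - 1 / 4"
    have "\<exists>x\<in>{a<..<a + \<epsilon>}. \<zeta> x \<noteq> 1" for a
    proof (rule ccontr)
      assume "\<not> ?thesis"
      then obtain y where "\<bar>1 - p y\<bar> \<le> 1 / 4" by (metis near)
      then show False using p[rule_format, of y] by linarith
    qed
    then show ?thesis by blast
  qed
qed

section \<open>Estimates in terms of the deficit \<open>D\<close>\<close>

text \<open>Twice the measure, per period, of the set where \<open>f\<close> is negative.\<close>

definition "D = integral {0..T} (\<lambda>x. 1 - \<zeta> x)"

lemma integrable_deficit [simp]: "(\<lambda>x. 1 - \<zeta> x) integrable_on {a..b}"
  by (intro integrable_diff) auto

lemma deficit_nonneg: "1 - \<zeta> x \<ge> 0"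
  using abs_le_D1[OF \<zeta>_le[of x]] by linarith

lemma D_nonneg: "D \<ge> 0"
  unfolding D_def by (rule Henstock_Kurzweil_Integration.integral_nonneg) (use deficit_nonneg in auto)

lemma deficit_shift: "integral {a..a + T} (\<lambda>x. 1 - \<zeta> x) = D"
proof -
  interpret f: periodic_fun_simple f T by (rule f_per)
  show ?thesis unfolding D_def
    by (rule integral_shift_periodic[OF T]) (rule periodic_fun_simple.intro, simp_all add: f.plus_1)
qed

lemma \<zeta>_mean_eq: "\<zeta>_mean = 1 - D / T"
proof -
  have "D = T - integral {0..T} \<zeta>"
    unfolding D_def using T by (subst integral_diff) auto
  then show ?thesis using T by (simp add: \<zeta>_mean_def period_mean_def field_simps)
qed

lemma h_le_D: "\<bar>h x\<bar> \<le> R * D"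
proof -
  have "(\<lambda>x. \<bar>\<zeta> x - 1\<bar>) = (\<lambda>x. 1 - \<zeta> x)"
    using deficit_nonneg by (auto simp: fun_eq_iff)
  then show ?thesis using h_le[of x 1] by (simp add: D_def)
qed

text \<open>With \<open>\<zeta>\<close> written as 1 minus its deficit and its mean as
  \<open>1 - D / T\<close>, the slope of \<open>g\<close> splits into a downward part, present only
  where \<open>f\<close> is not positive, and a drift \<open>D / (T * L\<^sub>o) + h\<close> of
  order \<open>D\<close>.\<close>

lemma increment_D:
  assumes "a \<le> b"
  shows "\<bar>g b - g a + integral {a..b} (\<lambda>x. 1 - \<zeta> x) / L\<^sub>o\<bar> \<le> (b - a) * (D * (1 / (T * L\<^sub>o) + R))"
proof -
  have "(\<zeta> x - \<zeta>_mean) / L\<^sub>o + h x = (D / (T * L\<^sub>o) + h x) - (1 - \<zeta> x) * (1 / L\<^sub>o)" for x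
    using T L\<^sub>o by (simp add: \<zeta>_mean_eq field_simps)
  then have "g b - g a = integral {a..b} (\<lambda>x. (D / (T * L\<^sub>o) + h x) - (1 - \<zeta> x) * (1 / L\<^sub>o))"
    using increment[OF assms, folded \<zeta>_mean_def] by presburger
  also have "\<dots> = integral {a..b} (\<lambda>x. D / (T * L\<^sub>o) + h x) - integral {a..b} (\<lambda>x. (1 - \<zeta> x) * (1 / L\<^sub>o))"
    by (rule integral_diff)
      (use T L\<^sub>o in \<open>auto intro!: integrable_continuous_interval continuous_intros integrable_on_mult_left\<close>)
  also have "integral {a..b} (\<lambda>x. (1 - \<zeta> x) * (1 / L\<^sub>o)) = integral {a..b} (\<lambda>x. 1 - \<zeta> x) / L\<^sub>o"
    using integral_mult_left[of "{a..b}" "\<lambda>x. 1 - \<zeta> x" "1 / L\<^sub>o"] by simp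
  finally have "g b - g a + integral {a..b} (\<lambda>x. 1 - \<zeta> x) / L\<^sub>o = integral {a..b} (\<lambda>x. D / (T * L\<^sub>o) + h x)"
    by simp
  also have "norm \<dots> \<le> D * (1 / (T * L\<^sub>o) + R) * (b - a)"
  proof (rule integral_bound[OF assms])
    show "continuous_on {a..b} (\<lambda>x. D / (T * L\<^sub>o) + h x)" using T L\<^sub>o by (intro continuous_intros) auto
    fix x
    have "norm (D / (T * L\<^sub>o) + h x) \<le> \<bar>D / (T * L\<^sub>o)\<bar> + \<bar>h x\<bar>"
      unfolding real_norm_def by (rule abs_triangle_ineq)
    also have "\<bar>D / (T * L\<^sub>o)\<bar> = D / (T * L\<^sub>o)" using D_nonneg T L\<^sub>o by simp
    finally show "norm (D / (T * L\<^sub>o) + h x) \<le> D * (1 / (T * L\<^sub>o) + R)"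
      using h_le_D[of x] by (simp add: algebra_simps)
  qed
  finally show ?thesis by (simp add: mult_ac)
qed

text \<open>Having mean zero, \<open>g\<close> vanishes at some \<open>z\<close>. Over one period
  from \<open>z\<close> the deficit contributes at most \<open>D / L\<^sub>o\<close> and the drift
  at most \<open>D / L\<^sub>o + R * T * D\<close>, hence the factor 2.\<close>

lemma integral_abs_g_le_D: "integral {0..T} (\<lambda>x. \<bar>g x\<bar>) \<le> T * ((2 / L\<^sub>o + R * T) * D)"
proof -
  interpret g: periodic_fun_simple g T by (rule g_per)
  have "continuous_on {0..T} g" by simp
  then obtain z where z: "integral {0..T} g = (T - 0) * g z"
    using integral_mean_value[OF T] by blast
  then have gz: "g z = 0" using g_mean T by simp
  have g_le: "\<bar>g x\<bar> \<le> (2 / L\<^sub>o + R * T) * D" if x: "x \<in> {z..z + T}" for x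
  proof -
    have "integral {z..x} (\<lambda>x. 1 - \<zeta> x) \<le> integral {z..z + T} (\<lambda>x. 1 - \<zeta> x)"
      by (rule integral_subset_le) (use x deficit_nonneg in auto)
    then have "integral {z..x} (\<lambda>x. 1 - \<zeta> x) \<le> D" unfolding deficit_shift .
    moreover have "integral {z..x} (\<lambda>x. 1 - \<zeta> x) \<ge> 0"
      by (rule Henstock_Kurzweil_Integration.integral_nonneg) (use deficit_nonneg in auto)
    ultimately have "\<bar>integral {z..x} (\<lambda>x. 1 - \<zeta> x) / L\<^sub>o\<bar> \<le> D / L\<^sub>o"
      using L\<^sub>o by (simp add: divide_right_mono)
    moreover have "(x - z) * (D * (1 / (T * L\<^sub>o) + R)) \<le> T * (D * (1 / (T * L\<^sub>o) + R))"
      using x D_nonneg T L\<^sub>o R by (intro mult_right_mono) auto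
    moreover have "T * (D * (1 / (T * L\<^sub>o) + R)) = D / L\<^sub>o + R * T * D"
      using T by (simp add: field_simps)
    moreover have "\<bar>g x + integral {z..x} (\<lambda>x. 1 - \<zeta> x) / L\<^sub>o\<bar> \<le> (x - z) * (D * (1 / (T * L\<^sub>o) + R))"
      using increment_D[of z x] x gz by simp
    ultimately have "\<bar>g x\<bar> \<le> D / L\<^sub>o + (D / L\<^sub>o + R * T * D)"
      by linarith
    then show ?thesis by (simp add: algebra_simps)
  qed
  have cont: "continuous_on A (\<lambda>x. \<bar>g x\<bar>)" for A by (intro continuous_intros) simp
  have "integral {0..T} (\<lambda>x. \<bar>g x\<bar>) = integral {z..z + T} (\<lambda>x. \<bar>g x\<bar>)"
    by (rule integral_shift_periodic[OF T, symmetric])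
      (rule periodic_fun_simple.intro, simp_all add: g.plus_1 integrable_continuous_interval cont)
  also have "\<dots> \<le> integral {z..z + T} (\<lambda>x. (2 / L\<^sub>o + R * T) * D)"
    by (rule integral_le) (use g_le in \<open>auto intro!: integrable_continuous_interval cont\<close>)
  finally show ?thesis using T by (simp add: mult.left_commute)
qed

text \<open>Since \<open>\<phi>\<close> has mean zero, \<open>\<zeta>\<close> may be replaced by
  \<open>\<zeta> - 1\<close> in \<open>integral_abs_f\<close>.\<close>

lemma integral_abs_f_le_D:
  assumes M: "\<And>x. \<bar>\<phi> x\<bar> \<le> M"
  shows "integral {0..T} (\<lambda>x. \<bar>f x\<bar>) \<le> M * D"
proof -
  note int = integrable_\<zeta>_mult[OF \<phi>_cont \<phi>_per]
  have int_\<phi>: "\<phi> integrable_on {0..T}" by (simp add: integrable_continuous_interval)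
  have "integral {0..T} (\<lambda>x. \<bar>f x\<bar>) = integral {0..T} (\<lambda>x. \<zeta> x * \<phi> x - \<phi> x)"
    using integral_diff[OF int int_\<phi>] by (simp add: integral_abs_f \<phi>_mean)
  also have "\<dots> \<le> integral {0..T} (\<lambda>x. M * (1 - \<zeta> x))"
  proof (rule integral_le)
    fix x
    have "(1 - \<zeta> x) * (- \<phi> x) \<le> (1 - \<zeta> x) * M"
      using M[of x] by (intro mult_left_mono deficit_nonneg) auto
    then show "\<zeta> x * \<phi> x - \<phi> x \<le> M * (1 - \<zeta> x)" by (simp add: algebra_simps)
  qed (auto intro!: integrable_diff int int_\<phi> integrable_on_mult_right)
  also have "\<dots> = M * D" by (simp add: D_def)
  finally show ?thesis .
qed

lemma integral_over_pieces:
  assumes "n \<le> m" 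
  shows "integral {t 1..t (Suc n)} (\<lambda>x. 1 - \<zeta> x) = (\<Sum>k=1..n. integral {t k..t (Suc k)} (\<lambda>x. 1 - \<zeta> x))"
  using assms
proof (induction n)
  case (Suc n)
  have "t 1 \<le> t (Suc n)" "t (Suc n) \<le> t (Suc (Suc n))"
    using Suc.prems by (auto intro!: zero_labelling_mono[OF T f_per lab])
  then have "integral {t 1..t (Suc n)} (\<lambda>x. 1 - \<zeta> x) + integral {t (Suc n)..t (Suc (Suc n))} (\<lambda>x. 1 - \<zeta> x)
      = integral {t 1..t (Suc (Suc n))} (\<lambda>x. 1 - \<zeta> x)"
    by (intro Henstock_Kurzweil_Integration.integral_combine) auto
  then show ?case using Suc by simp
qed simp

text \<open>Inside each of the \<open>m\<close> pieces of a period the deficit is constantly 0 or 2.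
  One piece carries at least \<open>D / m\<close>, so it is negative and at least
  \<open>D / (2 * m)\<close> long.\<close>

lemma long_negative_interval:
  assumes D: "D > 0"
  obtains a b where "a < b" "\<And>x. x \<in> {a<..<b} \<Longrightarrow> \<zeta> x = - 1" "D \<le> 2 * real m * (b - a)"
proof -
  have m: "m > 0" by (rule zero_labelling_pos[OF T f_per lab])
  have "D = (\<Sum>k=1..m. integral {t k..t (Suc k)} (\<lambda>x. 1 - \<zeta> x))"
    using integral_over_pieces[of m] deficit_shift[of "t 1"] lab by (simp add: zero_labelling_def)
  moreover have "(\<Sum>k=1..m. D / m) = D" using m by simp
  moreover have "(\<Sum>k=1..m. integral {t k..t (Suc k)} (\<lambda>x. 1 - \<zeta> x)) < (\<Sum>k=1..m. D / m)"
    if "\<And>k. k \<in> {1..m} \<Longrightarrow> integral {t k..t (Suc k)} (\<lambda>x. 1 - \<zeta> x) < D / m"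
    by (rule sum_strict_mono) (use m that in auto)
  ultimately have "\<not> (\<forall>k\<in>{1..m}. integral {t k..t (Suc k)} (\<lambda>x. 1 - \<zeta> x) < D / m)"
    by fastforce
  then obtain k where k: "k \<in> {1..m}" "D / m \<le> integral {t k..t (Suc k)} (\<lambda>x. 1 - \<zeta> x)"
    by (auto simp: not_less)
  have less: "t k < t (Suc k)" using k lab by (auto simp: zero_labelling_def)
  define c where "c = (t k + t (Suc k)) / 2"
  have c: "c \<in> {t k<..<t (Suc k)}" using less by (auto simp: c_def field_simps)
  note no0 = zero_labelling_no_zero[OF T f_per lab k(1)]
  have const: "\<zeta> x = \<zeta> c" if "x \<in> {t k<..<t (Suc k)}" for x
    by (rule sgn_eq_if_no_zero_between[OF f_cont no0 that c])
  have "integral {t k..t (Suc k)} (\<lambda>x. 1 - \<zeta> x) = integral {t k..t (Suc k)} (\<lambda>x. 1 - \<zeta> c)"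
    by (rule integral_spike[of "{t k, t (Suc k)}"]) (use const in auto)
  then have *: "D / m \<le> (1 - \<zeta> c) * (t (Suc k) - t k)"
    using k less by (simp add: mult.commute)
  have "D / m > 0" using D m by simp
  then have "\<zeta> c \<noteq> 1" using * by auto
  then have c1: "\<zeta> c = - 1" using no0[OF c] by (auto simp: sgn_if split: if_splits)
  show ?thesis
    by (rule that[OF less]) (use const c1 * m in \<open>auto simp: field_simps\<close>)
qed

text \<open>\<open>c\<close> will be a lower bound for \<open>\<mu> * D\<close>. On the scale
  \<open>3 * \<eta>\<close> the drift of \<open>g\<close> undoes at most half of its drop, and
  \<open>\<phi>\<close> varies by at most \<omega>. Finally \<epsilon> bounds the negative
  intervals, and through them \<open>D\<close> and the L^1 norm of \<open>f\<close>.\<close>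

lemma False_if_mostly_positive:
  fixes M A c \<eta> \<omega> \<epsilon> :: real
  assumes mostly: "\<And>a. \<exists>x\<in>{a<..<a + \<epsilon>}. \<zeta> x \<noteq> - 1"
    and M: "\<And>x. \<bar>\<phi> x\<bar> \<le> M" "M \<ge> 0"
    and A: "A = integral {0..T} (\<lambda>x. \<bar>\<phi> x\<bar>)" "A > 0"
    and c: "c = A / (2 * T * (2 / L\<^sub>o + R * T))"
    and \<eta>: "0 < \<eta>" "\<eta> \<le> T" "3 * \<eta> * (1 / (T * L\<^sub>o) + R) \<le> 1 / (2 * m * L\<^sub>o)"
    and \<omega>: "\<And>x y. \<bar>x - y\<bar> \<le> 3 * \<eta> \<Longrightarrow> \<bar>\<phi> x - \<phi> y\<bar> \<le> \<omega>" "2 * \<omega> < c / (2 * m * L\<^sub>o)"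
    and \<epsilon>: "0 < \<epsilon>" "\<epsilon> \<le> \<eta>" "4 * m * M * \<epsilon> / \<eta> \<le> \<omega>" "2 * m * M * \<epsilon> \<le> A / 2"
  shows False
proof -
  have m: "m > 0" by (rule zero_labelling_pos[OF T f_per lab])
  have short: "b - a \<le> \<epsilon>" if neg: "\<And>x. x \<in> {a<..<b} \<Longrightarrow> \<zeta> x = - 1" for a b
  proof (rule ccontr)
    assume "\<not> ?thesis"
    then have "{a<..<a + \<epsilon>} \<subseteq> {a<..<b}" by auto
    then show False using mostly[of a] neg by blast
  qed
  have D_le: "D \<le> 2 * m * \<epsilon>"
  proof (cases "D > 0")
    case True
    then obtain a b where "\<And>x. x \<in> {a<..<b} \<Longrightarrow> \<zeta> x = - 1" "D \<le> 2 * real m * (b - a)"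
      using long_negative_interval by blast
    then show ?thesis using short[of a b] mult_left_mono[of "b - a" \<epsilon> "2 * real m"] by fastforce
  qed (use \<epsilon> in \<open>auto intro: order_trans[of _ 0]\<close>)
  define N where "N = integral {0..T} (\<lambda>x. \<bar>f x\<bar>)"
  have "N \<le> M * D" unfolding N_def by (rule integral_abs_f_le_D[OF M(1)])
  also have "\<dots> \<le> M * (2 * m * \<epsilon>)" using M D_le by (intro mult_left_mono) auto
  finally have N: "N \<le> 2 * m * M * \<epsilon>" by (simp add: mult_ac)
  \<comment> \<open>By the choice of \<epsilon>, \<open>f\<close> accounts for at most half of
    \<open>A\<close>. The other half must come from \<open>\<mu> * g\<close>, whose norm is at most
    a multiple of \<open>\<mu> * D\<close>; solving for \<open>\<mu> * D\<close> gives
    \<open>c\<close>.\<close>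
  have "A \<le> integral {0..T} (\<lambda>x. \<bar>f x\<bar> + \<mu> * \<bar>g x\<bar>)"
    unfolding A
  proof (rule integral_le)
    fix x
    have "\<phi> x = f x + \<mu> * g x" by (simp add: f_eq)
    then have "\<bar>\<phi> x\<bar> \<le> \<bar>f x\<bar> + \<bar>\<mu> * g x\<bar>" by simp
    then show "\<bar>\<phi> x\<bar> \<le> \<bar>f x\<bar> + \<mu> * \<bar>g x\<bar>" using \<mu> by (simp add: abs_mult)
  qed (auto intro!: integrable_continuous_interval continuous_intros)
  also have "\<dots> = N + \<mu> * integral {0..T} (\<lambda>x. \<bar>g x\<bar>)"
    unfolding N_def by (subst integral_add) (auto intro!: integrable_continuous_interval continuous_intros)
  also have "\<dots> \<le> A / 2 + \<mu> * (T * ((2 / L\<^sub>o + R * T) * D))"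
    using \<mu> N \<epsilon> integral_abs_g_le_D by (intro add_mono mult_left_mono) auto
  finally have "A \<le> A / 2 + \<mu> * (T * ((2 / L\<^sub>o + R * T) * D))" .
  moreover have "2 * (\<mu> * (T * ((2 / L\<^sub>o + R * T) * D))) = (\<mu> * D) * (2 * T * (2 / L\<^sub>o + R * T))"
    by (simp only: mult_ac)
  ultimately have "A \<le> (\<mu> * D) * (2 * T * (2 / L\<^sub>o + R * T))" by linarith
  moreover have "2 * T * (2 / L\<^sub>o + R * T) > 0" using T L\<^sub>o R by (intro mult_pos_pos add_pos_nonneg) auto
  ultimately have \<mu>D: "c \<le> \<mu> * D" and "c > 0" unfolding c using A(2) by (simp_all add: pos_divide_le_eq)
  then have "D > 0" using \<mu> by (metis less_le_trans zero_less_mult_pos)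
  then obtain a b where ab: "a < b" "\<And>x. x \<in> {a<..<b} \<Longrightarrow> \<zeta> x = - 1" "D \<le> 2 * real m * (b - a)"
    using long_negative_interval by blast
  have "b - a \<le> \<epsilon>" using short ab(2) by blast
  \<comment> \<open>\<open>u\<close> and \<open>v\<close> enclose the negative interval,
    \<open>f\<close> is small at both, and they are at most
    \<open>\<eta> + \<epsilon> + \<eta>\<close> apart.\<close>
  obtain u where u: "u \<in> {a - \<eta>..a - \<eta> + \<eta>}" "\<bar>f u\<bar> \<le> N / \<eta>"
    unfolding N_def by (rule periodic_small_value[OF T f_cont f_per \<eta>(1,2)])
  obtain v where v: "v \<in> {b..b + \<eta>}" "\<bar>f v\<bar> \<le> N / \<eta>"
    unfolding N_def by (rule periodic_small_value[OF T f_cont f_per \<eta>(1,2)])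
  have uv: "u \<le> a" "b \<le> v" "u \<le> v" "v - u \<le> 3 * \<eta>" using u v ab \<open>b - a \<le> \<epsilon>\<close> \<epsilon> by auto
  have "N / \<eta> \<le> 2 * m * M * \<epsilon> / \<eta>" using N \<eta> by (intro divide_right_mono) auto
  then have "2 * (N / \<eta>) \<le> \<omega>" using \<epsilon>(3) by simp
  then have f_vu: "f v - f u \<le> \<omega>" using u v by linarith
  have "2 * (b - a) = integral {a..b} (\<lambda>x. 2)" using ab by simp
  also have "\<dots> = integral {a..b} (\<lambda>x. 1 - \<zeta> x)"
    by (rule integral_spike[of "{a, b}"]) (use ab in auto)
  also have "\<dots> \<le> integral {u..v} (\<lambda>x. 1 - \<zeta> x)"
    by (rule integral_subset_le) (use uv deficit_nonneg in auto)
  finally have "real m * (2 * (b - a)) \<le> real m * integral {u..v} (\<lambda>x. 1 - \<zeta> x)"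
    by (intro mult_left_mono) auto
  then have "D \<le> integral {u..v} (\<lambda>x. 1 - \<zeta> x) * real m" using ab(3) by (simp add: mult_ac)
  then have "D / m \<le> integral {u..v} (\<lambda>x. 1 - \<zeta> x)" using m by (simp add: pos_divide_le_eq)
  then have "D / m / L\<^sub>o \<le> integral {u..v} (\<lambda>x. 1 - \<zeta> x) / L\<^sub>o" using L\<^sub>o by (intro divide_right_mono) auto
  moreover have "(v - u) * (D * (1 / (T * L\<^sub>o) + R)) \<le> D * (1 / (2 * m * L\<^sub>o))"
  proof -
    have "(v - u) * (D * (1 / (T * L\<^sub>o) + R)) \<le> 3 * \<eta> * (D * (1 / (T * L\<^sub>o) + R))"
      using uv D_nonneg T L\<^sub>o R by (intro mult_right_mono) auto
    also have "\<dots> = D * (3 * \<eta> * (1 / (T * L\<^sub>o) + R))" by simp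
    also have "\<dots> \<le> D * (1 / (2 * m * L\<^sub>o))" by (intro mult_left_mono \<eta> D_nonneg)
    finally show ?thesis .
  qed
  moreover have "D / m / L\<^sub>o = 2 * (D * (1 / (2 * m * L\<^sub>o)))" using m L\<^sub>o by (simp add: field_simps)
  \<comment> \<open>The deficit lowers \<open>g\<close> by at least
    \<open>D / (m * L\<^sub>o)\<close>, of which the drift restores at most half.\<close>
  ultimately have "g v - g u \<le> - (D * (1 / (2 * m * L\<^sub>o)))"
    using increment_D[OF uv(3)] unfolding abs_le_iff by linarith
  then have "\<mu> * (g v - g u) \<le> \<mu> * (- (D * (1 / (2 * m * L\<^sub>o))))" using \<mu> by (intro mult_left_mono) auto
  also have "\<dots> = - (\<mu> * D / (2 * m * L\<^sub>o))" by simp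
  also have "\<dots> \<le> - (c / (2 * m * L\<^sub>o))" using \<mu>D L\<^sub>o by (simp add: divide_right_mono)
  finally have "\<mu> * (g v - g u) \<le> - (c / (2 * m * L\<^sub>o))" .
  moreover have "f v - f u = \<phi> v - \<phi> u - \<mu> * (g v - g u)" by (simp add: f_eq algebra_simps)
  moreover have "\<bar>\<phi> v - \<phi> u\<bar> \<le> \<omega>" using uv by (intro \<omega>) auto
  \<comment> \<open>The term \<open>\<mu> * g\<close> raises \<open>f\<close> by more than
    \<open>2 * \<omega>\<close> and \<open>\<phi>\<close> lowers it by at most \<omega>, so
    \<open>f\<close> would rise by more than the \<omega> that \<open>f_vu\<close> permits.\<close>
  ultimately show False using f_vu \<omega>(2) by linarith
qed

end

section \<open>Choice of the constants\<close>

lemma eventually_mult_le_at_right_0: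
  fixes K c :: real
  assumes "c > 0"
  shows "\<forall>\<^sub>F x in at_right 0. K * x \<le> c"
proof -
  have "((\<lambda>x. K * x) \<longlongrightarrow> K * 0) (at_right 0)" by (intro tendsto_intros)
  then have "\<forall>\<^sub>F x in at_right 0. K * x < c" by (rule order_tendstoD) (use assms in simp)
  then show ?thesis by eventually_elim simp
qed

text \<open>The constants are chosen in the order \<open>c\<close>, \<omega>, \<eta>, \<epsilon>,
  \<open>\<mu>\<^sub>0\<close>, each from the data and the earlier ones, so one threshold works for
  every candidate solution.\<close>

lemma no_wave_solution_for_large_\<mu>:
  fixes T L\<^sub>o R d :: real and m :: nat and \<phi> :: "real \<Rightarrow> real"
  assumes T: "T > 0" and L\<^sub>o: "L\<^sub>o > 0" and R: "R \<ge> 0" and d: "d > 0"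
    and \<phi>_cont: "continuous_on UNIV \<phi>" and \<phi>_per: "periodic_fun_simple \<phi> T" and \<phi>_nz: "\<phi> x\<^sub>0 \<noteq> 0"
  shows "\<exists>\<mu>\<^sub>0>0. \<forall>\<mu> f g h t. \<mu> \<ge> \<mu>\<^sub>0 \<longrightarrow> \<not> wave_solution T L\<^sub>o R d \<mu> m \<phi> f g h t"
\<comment> \<open>\<open>m\<close> is about to appear in denominators. For \<open>m = 0\<close> a
  labelling would require \<open>t 1 = t 1 + T\<close>.\<close>
proof (cases "m = 0")
  case True
  then have "\<not> wave_solution T L\<^sub>o R d \<mu> m \<phi> f g h t" for \<mu> f g h t
    using zero_labelling_pos[OF T, of f m t] by (auto simp: wave_solution_def)
  then show ?thesis by (intro exI[of _ 1]) simp
next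
  case False
  define A where "A = integral {0..T} (\<lambda>x. \<bar>\<phi> x\<bar>)"
  have cont_abs: "continuous_on S (\<lambda>x. \<bar>\<phi> x\<bar>)" for S
    by (intro continuous_intros continuous_on_subset[OF \<phi>_cont]) simp
  have A: "A > 0"
  proof -
    interpret periodic_fun_simple \<phi> T by (rule \<phi>_per)
    have "integral {x\<^sub>0..x\<^sub>0 + T} (\<lambda>x. \<bar>\<phi> x\<bar>) = A" unfolding A_def
      by (rule integral_shift_periodic[OF T])
        (rule periodic_fun_simple.intro, simp_all add: plus_1 integrable_continuous_interval cont_abs)
    moreover have "integral {x\<^sub>0..x\<^sub>0 + T} (\<lambda>x. \<bar>\<phi> x\<bar>) \<noteq> 0"
      using integral_eq_0_iff[OF cont_abs, of x\<^sub>0 "x\<^sub>0 + T"] T \<phi>_nz by auto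
    moreover have "integral {x\<^sub>0..x\<^sub>0 + T} (\<lambda>x. \<bar>\<phi> x\<bar>) \<ge> 0"
      by (rule Henstock_Kurzweil_Integration.integral_nonneg) (auto intro: integrable_continuous_interval cont_abs)
    ultimately show ?thesis by simp
  qed
  obtain M where M: "M > 0" "\<And>x. \<bar>\<phi> x\<bar> \<le> M" using periodic_bounded[OF T \<phi>_cont \<phi>_per] by blast
  define c where "c = A / (2 * T * (2 / L\<^sub>o + R * T))"
  have c: "c > 0" unfolding c_def using A T L\<^sub>o R
    by (intro divide_pos_pos mult_pos_pos add_pos_nonneg) auto
  \<comment> \<open>With the 8, \<open>2 * \<omega>\<close> is half of the bound
    \<open>c / (2 * m * L\<^sub>o)\<close> that it has to stay below.\<close>
  define \<omega> where "\<omega> = c / (8 * m * L\<^sub>o)"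
  have \<omega>: "\<omega> > 0" "2 * \<omega> < c / (2 * m * L\<^sub>o)"
    using c L\<^sub>o False by (simp_all add: \<omega>_def field_simps)
  obtain d' where d': "d' > 0" "\<And>x y. \<bar>x - y\<bar> < d' \<Longrightarrow> \<bar>\<phi> x - \<phi> y\<bar> < \<omega>"
    using periodic_uniformly_continuous[OF T \<phi>_cont \<phi>_per \<omega>(1)] by blast
  have "1 / (2 * m * L\<^sub>o) > 0" using L\<^sub>o False by simp
  \<comment> \<open>The factor in \<open>1 * \<eta>\<close> gives this bound the shape
    \<open>K * x \<le> c\<close> of the preceding lemma; the strict bound by \<open>d'\<close> is
    obtained from \<open>d' / 2\<close>.\<close>
  then have "\<forall>\<^sub>F \<eta> in at_right 0. 0 < \<eta> \<and> 1 * \<eta> \<le> T \<and> 3 * \<eta> < d' \<and>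
      3 * (1 / (T * L\<^sub>o) + R) * \<eta> \<le> 1 / (2 * m * L\<^sub>o)"
    using eventually_mult_le_at_right_0[of "d' / 2" 3] d' T
    by (intro eventually_conj eventually_at_right_less eventually_mult_le_at_right_0)
      (auto elim: eventually_mono)
  then obtain \<eta> where \<eta>: "0 < \<eta>" "\<eta> \<le> T" "3 * \<eta> < d'" "3 * \<eta> * (1 / (T * L\<^sub>o) + R) \<le> 1 / (2 * m * L\<^sub>o)"
    using eventually_happens[of _ "at_right (0::real)"] by (auto simp: mult_ac)
  have "\<forall>\<^sub>F \<epsilon> in at_right 0. 0 < \<epsilon> \<and> 1 * \<epsilon> \<le> \<eta> \<and> (4 * m * M / \<eta>) * \<epsilon> \<le> \<omega> \<and> (2 * m * M) * \<epsilon> \<le> A / 2 \<and>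
      real (m + 1) * \<epsilon> \<le> T \<and> real (m + 1) * \<epsilon> \<le> d"
    using \<eta> \<omega> A T d
    by (intro eventually_conj eventually_at_right_less eventually_mult_le_at_right_0) auto
  then obtain \<epsilon> where \<epsilon>: "0 < \<epsilon>" "\<epsilon> \<le> \<eta>" "4 * m * M * \<epsilon> / \<eta> \<le> \<omega>" "2 * m * M * \<epsilon> \<le> A / 2"
      "real (m + 1) * \<epsilon> \<le> T" "real (m + 1) * \<epsilon> \<le> d"
    using eventually_happens[of _ "at_right (0::real)"] by auto
  \<comment> \<open>The smallest \<mu> that satisfies the hypothesis \<open>large\<close> of
    \<open>one_sign_dominates\<close> for this \<epsilon>.\<close>
  define \<mu>\<^sub>0 where "\<mu>\<^sub>0 = 144 * L\<^sub>o * A / \<epsilon>\<^sup>2"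
  have \<mu>\<^sub>0: "\<mu>\<^sub>0 > 0" using L\<^sub>o A \<epsilon> by (simp add: \<mu>\<^sub>0_def)
  have False if \<mu>: "\<mu> \<ge> \<mu>\<^sub>0" and sol: "wave_solution T L\<^sub>o R d \<mu> m \<phi> f g h t" for \<mu> f g h t
  proof -
    interpret pos: wave_solution T L\<^sub>o R d \<mu> m \<phi> f g h t by (rule sol)
    interpret neg: wave_solution T L\<^sub>o R d \<mu> m "\<lambda>x. - \<phi> x" "\<lambda>x. - f x" "\<lambda>x. - g x" "\<lambda>x. - h x" t
      by (rule pos.wave_solution_uminus)
    have \<omega>': "\<bar>\<phi> x - \<phi> y\<bar> \<le> \<omega>" if "\<bar>x - y\<bar> \<le> 3 * \<eta>" for x y
      using d'(2)[of x y] \<eta>(3) that by simp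
    have "144 * L\<^sub>o * A \<le> \<mu> * \<epsilon>\<^sup>2" using \<mu> \<epsilon> by (simp add: \<mu>\<^sub>0_def field_simps)
    then consider "\<forall>a. \<exists>x\<in>{a<..<a + \<epsilon>}. sgn (f x) \<noteq> - 1" | "\<forall>a. \<exists>x\<in>{a<..<a + \<epsilon>}. sgn (f x) \<noteq> 1"
      using pos.one_sign_dominates[OF \<epsilon>(1,5,6)] unfolding A_def by blast
    then show False
    proof cases
      case 1
      show False
        by (rule pos.False_if_mostly_positive[where \<epsilon> = \<epsilon> and \<eta> = \<eta> and \<omega> = \<omega>, OF _ _ _ A_def A c_def \<eta>(1,2,4) _ \<omega>(2) \<epsilon>(1-4)])
          (use 1 M \<omega>' in auto)
    next
      case 2
      have A': "A = integral {0..T} (\<lambda>x. \<bar>- \<phi> x\<bar>)" by (simp add: A_def)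
      show False
        by (rule neg.False_if_mostly_positive[where \<epsilon> = \<epsilon> and \<eta> = \<eta> and \<omega> = \<omega>, OF _ _ _ A' A c_def \<eta>(1,2,4) _ \<omega>(2) \<epsilon>(1-4)])
          (use 2 M \<omega>' in \<open>auto simp: sgn_minus abs_minus_commute\<close>)
    qed
  qed
  then show ?thesis using \<mu>\<^sub>0 by blast
qed

section \<open>Application to the operator\<close>

lemma admissible_operator_output:
  assumes T: "T > 0" and L: "admissible_operator T L" and \<zeta>: "wave_input T \<zeta>"
  shows "continuous_on UNIV (L \<zeta>)" "periodic_fun_simple (L \<zeta>) T"
    "integral {0..T} (L \<zeta>) = 0" "integral {0..T} (\<lambda>x. \<zeta> x * L \<zeta> x) = 0"
proof -
  have bp: "\<zeta> \<in> bounded_periodic T"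
    using \<zeta> unfolding bounded_periodic_def wave_input_def
    by (auto simp: bounded_iff intro!: measurable_completion)
  from L obtain l :: "real \<Rightarrow> complex" where l:
    "continuous_on UNIV (L \<zeta>)" "periodic_fun_simple (L \<zeta>) T" "l 0 = 0"
    "fourier_coeff T (L \<zeta>) 0 = l (of_int 0 * (2 * pi / T)) * fourier_coeff T \<zeta> 0"
    "period_mean T (\<lambda>x. \<zeta> x * L \<zeta> x) = 0"
    unfolding admissible_operator_def using bp by blast
  show "continuous_on UNIV (L \<zeta>)" "periodic_fun_simple (L \<zeta>) T" by (rule l)+
  show "integral {0..T} (\<lambda>x. \<zeta> x * L \<zeta> x) = 0" using l(5) T by (simp add: period_mean_def)
  have "L \<zeta> integrable_on {0..T}"
    by (intro integrable_continuous_interval continuous_on_subset[OF l(1)]) simp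
  then have "complex_of_real (integral {0..T} (L \<zeta>)) = integral {0..T} (\<lambda>x. complex_of_real (L \<zeta> x))"
    using integral_linear[OF _ bounded_linear_of_real[where ?'a = complex], of "L \<zeta>" "{0..T}"]
    by (simp add: o_def)
  also have "\<dots> = 0" using l(3,4) T by (simp add: fourier_coeff_def period_mean_def)
  finally show "integral {0..T} (L \<zeta>) = 0" by simp
qed

theorem mainTheorem4:
  fixes T :: real and \<phi> :: "real \<Rightarrow> real" and m\<^sub>o :: nat and t\<^sub>o :: "nat \<Rightarrow> real"
    and L :: "(real \<Rightarrow> real) \<Rightarrow> (real \<Rightarrow> real)"
  assumes "T > 0"
    and "zc_function T \<phi>"
    and "zero_labelling T \<phi> m\<^sub>o t\<^sub>o"
    and "admissible_operator T L"
  shows "mu_crit T m\<^sub>o \<phi> t\<^sub>o L < \<infinity>"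
proof -
  note T = \<open>T > 0\<close> and L = \<open>admissible_operator T L\<close>
  obtain L\<^sub>o R d where L\<^sub>o: "L\<^sub>o > 0" and R: "R \<ge> 0" and d: "d > 0"
    and L_increment: "\<And>\<zeta>. wave_input T \<zeta> \<Longrightarrow>
      \<exists>h. continuous_on UNIV h \<and>
        (\<forall>a b. a \<le> b \<longrightarrow> L \<zeta> b - L \<zeta> a = integral {a..b} (\<lambda>x. (\<zeta> x - period_mean T \<zeta>) / L\<^sub>o + h x)) \<and>
        (\<forall>c x. \<bar>h x\<bar> \<le> R * integral {0..T} (\<lambda>x. \<bar>\<zeta> x - c\<bar>)) \<and>
        (\<forall>x y. \<bar>x - y\<bar> \<le> d \<longrightarrow> L\<^sub>o * \<bar>h x - h y\<bar> \<le> 1 / 4)"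
    by (rule admissible_operator_increment[OF T L]) (rule that, assumption+)
  obtain x\<^sub>0 where \<phi>: "continuous_on UNIV \<phi>" "periodic_fun_simple \<phi> T" "\<phi> x\<^sub>0 \<noteq> 0" "integral {0..T} \<phi> = 0"
    using \<open>zc_function T \<phi>\<close> T unfolding zc_function_def period_mean_def by auto
  obtain \<mu>\<^sub>0 where \<mu>\<^sub>0: "\<mu>\<^sub>0 > 0" "\<And>f g h t. \<not> wave_solution T L\<^sub>o R d \<mu>\<^sub>0 m\<^sub>o \<phi> f g h t"
    using no_wave_solution_for_large_\<mu>[OF T L\<^sub>o R d \<phi>(1-3)] by blast
  \<comment> \<open>A range of solvability reaching beyond \<open>\<mu>\<^sub>0\<close> contains
    \<open>\<mu>\<^sub>0\<close> itself, and the solution at that value would be a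
    \<open>wave_solution\<close>.\<close>
  have "\<mu>\<^sub>s \<le> \<mu>\<^sub>0" if solvable: "solvable_up_to T m\<^sub>o \<phi> t\<^sub>o L \<mu>\<^sub>s" for \<mu>\<^sub>s
  proof (rule ccontr)
    assume "\<not> \<mu>\<^sub>s \<le> \<mu>\<^sub>0"
    then have "\<mu>\<^sub>0 \<in> {0..<\<mu>\<^sub>s}" using \<mu>\<^sub>0 by simp
    from solvable obtain F \<tau> where sol:
        "\<forall>\<mu>\<in>{0..<\<mu>\<^sub>s}. same_zc_features T m\<^sub>o \<phi> t\<^sub>o (F \<mu>) (\<tau> \<mu>) \<and>
           (\<forall>x. F \<mu> x = \<phi> x - \<mu> * L (\<lambda>y. sgn (F \<mu> y)) x)"
      unfolding solvable_up_to_def by (elim exE conjE) (rule that)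
    define f t where "f = F \<mu>\<^sub>0" and "t = \<tau> \<mu>\<^sub>0"
    have f: "same_zc_features T m\<^sub>o \<phi> t\<^sub>o f t" "\<And>x. f x = \<phi> x - \<mu>\<^sub>0 * L (\<lambda>y. sgn (f y)) x"
      using bspec[OF sol \<open>\<mu>\<^sub>0 \<in> {0..<\<mu>\<^sub>s}\<close>, THEN conjunct1]
        bspec[OF sol \<open>\<mu>\<^sub>0 \<in> {0..<\<mu>\<^sub>s}\<close>, THEN conjunct2, rule_format]
      unfolding f_def t_def by this
    have f': "continuous_on UNIV f" "periodic_fun_simple f T" "zero_labelling T f m\<^sub>o t"
      using f(1) unfolding same_zc_features_def zc_function_def by auto
    have wave: "wave_input T (\<lambda>y. sgn (f y))" by (rule wave_input_sgn[OF T f'(2,3,1)])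
    note out = admissible_operator_output[OF T L wave]
    obtain h where h: "continuous_on UNIV h"
        "\<forall>a b. a \<le> b \<longrightarrow> L (\<lambda>y. sgn (f y)) b - L (\<lambda>y. sgn (f y)) a
           = integral {a..b} (\<lambda>x. (sgn (f x) - period_mean T (\<lambda>y. sgn (f y))) / L\<^sub>o + h x)"
        "\<forall>c x. \<bar>h x\<bar> \<le> R * integral {0..T} (\<lambda>x. \<bar>sgn (f x) - c\<bar>)"
        "\<forall>x y. \<bar>x - y\<bar> \<le> d \<longrightarrow> L\<^sub>o * \<bar>h x - h y\<bar> \<le> 1 / 4"
      using L_increment[OF wave] by (elim exE conjE) (rule that)
    have "wave_solution T L\<^sub>o R d \<mu>\<^sub>0 m\<^sub>o \<phi> f (L (\<lambda>y. sgn (f y))) h t"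
      by (rule wave_solution.intro)
        (fact T L\<^sub>o R \<mu>\<^sub>0(1) \<phi> f' f(2) out h(1) h(2)[rule_format] h(3)[rule_format] h(4)[rule_format])+
    then show False using \<mu>\<^sub>0(2) by blast
  qed
  then have "mu_crit T m\<^sub>o \<phi> t\<^sub>o L \<le> ennreal \<mu>\<^sub>0"
    unfolding mu_crit_def by (intro Sup_least) (auto intro: ennreal_leI)
  also have "\<dots> < \<infinity>" by simp
  finally show ?thesis .
qed

end
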